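(* Let $G$ be a finite group all of whose Sylow subgroups are cyclic, and let $R$ be a commutative ring. Then for every subgroup $H \leq G$, $$\mathrm{N}_{\mathrm{U}(RG)}(H) = \mathrm{N}_G(H)\cdot \mathrm{C}_{\mathrm{U}(RG)}(H).$$ In particular, this holds for every group $G$ of square-free order, every subgroup $H\leq G$ and every commutative ring $R$.
   Context: Rings have an identity element $1$, and $R \neq 0$. $RG$ is the group ring of $G$ over $R$ and $\mathrm{U}(RG)$ its group of units; $G$ is regarded as a subgroup of $\mathrm{U}(RG)$. For a group $X$ containing $H$ as a subgroup, $\mathrm{N}_X(H)=\{x\in X : x^{-1}Hx=H\}$ is the normalizer and $\mathrm{C}_X(H)$ the centralizer of $H$ in $X$. *)

theory Defs
  imports "HOL-Algebra.Algebra" "HOL-Computational_Algebra.Squarefree"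
begin

text \<open>
  Elements of the group ring are the finitely supported functions from \<open>G\<close> to \<open>R\<close>; the function
  \<open>a\<close> stands for the formal sum of the \<open>a g \<cdot> g\<close>. Functions are made extensional so that equality in
  the carrier is equality of formal sums. In the product, the coefficient of \<open>x\<close> is the sum of
  \<open>a y \<cdot> b z\<close> over all pairs with \<open>y z = x\<close>; it is taken over the (finite) support of \<open>a\<close> because
  \<open>finsum\<close> over an infinite index set is \<open>\<zero>\<close> by convention.
\<close>

definition group_ring ::
  "('r, 'm) ring_scheme \<Rightarrow> ('g, 'n) monoid_scheme \<Rightarrow> ('g \<Rightarrow> 'r) ring" where
  "group_ring R G =
    \<lparr> carrier = {a \<in> carrier G \<rightarrow>\<^sub>E carrier R. finite {g \<in> carrier G. a g \<noteq> \<zero>\<^bsub>R\<^esub>}},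
      monoid.mult = (\<lambda>a b. \<lambda>x \<in> carrier G.
        \<Oplus>\<^bsub>R\<^esub>y \<in> {y \<in> carrier G. a y \<noteq> \<zero>\<^bsub>R\<^esub>}. a y \<otimes>\<^bsub>R\<^esub> b (inv\<^bsub>G\<^esub> y \<otimes>\<^bsub>G\<^esub> x)),
      one = (\<lambda>x \<in> carrier G. if x = \<one>\<^bsub>G\<^esub> then \<one>\<^bsub>R\<^esub> else \<zero>\<^bsub>R\<^esub>),
      ring.zero = (\<lambda>x \<in> carrier G. \<zero>\<^bsub>R\<^esub>),
      ring.add = (\<lambda>a b. \<lambda>x \<in> carrier G. a x \<oplus>\<^bsub>R\<^esub> b x) \<rparr>"

definition group_ring_embed ::
  "('r, 'm) ring_scheme \<Rightarrow> ('g, 'n) monoid_scheme \<Rightarrow> 'g \<Rightarrow> 'g \<Rightarrow> 'r" where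
  "group_ring_embed R G g = (\<lambda>x \<in> carrier G. if x = g then \<one>\<^bsub>R\<^esub> else \<zero>\<^bsub>R\<^esub>)"

text \<open>
  Normalizers are the library's \<open>normalizer\<close>, the set of \<open>x\<close> with \<open>x H x\<^sup>-\<^sup>1 = H\<close>; for each
  \<open>x\<close> in the group this condition is equivalent to \<open>x\<^sup>-\<^sup>1 H x = H\<close>.
\<close>

definition centralizer :: "('g, 'n) monoid_scheme \<Rightarrow> 'g set \<Rightarrow> 'g set" where
  "centralizer G H = {x \<in> carrier G. \<forall>h \<in> H. x \<otimes>\<^bsub>G\<^esub> h = h \<otimes>\<^bsub>G\<^esub> x}"

definition sylow_subgroup :: "nat \<Rightarrow> 'g set \<Rightarrow> ('g, 'n) monoid_scheme \<Rightarrow> bool" where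
  "sylow_subgroup p P G \<longleftrightarrow>
    Factorial_Ring.prime p \<and> subgroup P G \<and> card P = p ^ Factorial_Ring.multiplicity p (Coset.order G)"

end

theory Submission
  imports Defs "HOL-Number_Theory.Residues"
begin

text \<open>
  Let \<open>u\<close> be a unit of \<open>RG\<close> that normalizes \<open>H\<close>, and let \<open>\<phi>\<close> be the automorphism of \<open>H\<close> induced by
  conjugation with \<open>u\<close>. If \<open>\<phi>\<close> is also induced by some \<open>g \<in> G\<close>, then \<open>g\<close> normalizes \<open>H\<close> and \<open>g\<^sup>-\<^sup>1 u\<close>
  centralizes it. So the theorem says that \<open>\<phi>\<close> is conjugation by an element of \<open>G\<close>.

  The group ring enters only through one observation. For a conjugacy class \<open>S\<close> of \<open>G\<close>, the sum of
  the coefficients over \<open>S\<close> takes the same value on \<open>a b\<close> and on \<open>b a\<close> (\<open>class_sum_commute\<close>). Hence two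
  elements of \<open>G\<close> that are conjugate under a unit have the same class sums, and as \<open>\<one> \<noteq> \<zero>\<close> in \<open>R\<close>
  they are conjugate in \<open>G\<close> (\<open>unit_conj_imp_group_conj\<close>). So every \<open>\<phi> h\<close> is conjugate to \<open>h\<close>
  in \<open>G\<close>, with a conjugating element that may depend on \<open>h\<close>.

  The rest is group theory: if all Sylow subgroups of \<open>G\<close> are cyclic, one conjugating element serves
  for all \<open>h\<close> (\<open>pointwise_conj_hom_is_conj\<close>). Let \<open>A\<close> be the derived subgroup of \<open>G\<close>. It is abelian
  (\<open>derived_abelian\<close>) and its order is coprime to its index (\<open>derived_hall\<close>). An abelian
  section of \<open>G\<close> is cyclic, so \<open>H\<close> is generated by a generator \<open>b\<close> of \<open>H \<inter> A\<close> and one more element \<open>d\<close>,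
  which can be chosen of order dividing \<open>[G : A]\<close>. Take \<open>g\<close> with \<open>\<phi> b = g b g\<^sup>-\<^sup>1\<close>. Since \<open>G/A\<close> is
  abelian, \<open>d\<close> and \<open>g\<^sup>-\<^sup>1 (\<phi> d) g\<close> lie in the same coset of \<open>A\<close>, and by coprimality they are conjugate
  under some element of \<open>A\<close> (\<open>coprime_complement_conj\<close>). As \<open>A\<close> centralizes \<open>b\<close>, this correction of \<open>g\<close>
  does not change its effect on \<open>b\<close>.

  The two facts about \<open>A\<close> come from the transfer into a cyclic Sylow subgroup \<open>P\<close>: either \<open>P \<inter> A\<close> is
  trivial or \<open>P \<le> A\<close>, and it is trivial for the smallest prime divisor of the order
  (\<open>sylow_derived_dichotomy\<close>). The first statement gives the coprimality; the second makes
  \<open>A\<close> a proper subgroup, so that an induction on the order can be used to show that \<open>A\<close> is abelian.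
\<close>

section \<open>Powers, conjugates and cosets\<close>

lemma (in group) cancel_inv:
  assumes "g \<in> carrier G" "x \<in> carrier G"
  shows "inv g \<otimes> (g \<otimes> x) = x" "g \<otimes> (inv g \<otimes> x) = x"
  using assms by (simp_all flip: m_assoc)

lemma (in group) conj_nat_pow:
  assumes "g \<in> carrier G" "x \<in> carrier G"
  shows "(g \<otimes> x \<otimes> inv g) [^] (n::nat) = g \<otimes> x [^] n \<otimes> inv g"
proof (induction n)
  case 0
  then show ?case using assms by simp
next
  case (Suc n)
  have "(g \<otimes> x \<otimes> inv g) [^] Suc n = (g \<otimes> x [^] n \<otimes> inv g) \<otimes> (g \<otimes> x \<otimes> inv g)"
    using Suc by simp
  also have "\<dots> = g \<otimes> x [^] n \<otimes> (inv g \<otimes> g) \<otimes> x \<otimes> inv g"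
    using assms by (simp add: m_assoc cancel_inv)
  also have "\<dots> = g \<otimes> x [^] Suc n \<otimes> inv g"
    using assms by (simp add: m_assoc)
  finally show ?case .
qed

lemma (in group) rcoset_eq_iff:
  assumes "subgroup P G" "s \<in> carrier G" "t \<in> carrier G"
  shows "P #> s = P #> t \<longleftrightarrow> s \<otimes> inv t \<in> P"
proof
  assume "P #> s = P #> t"
  then have "s \<in> P #> t" using rcos_self[OF assms(2,1)] by simp
  then show "s \<otimes> inv t \<in> P"
    using subgroup.rcos_module_imp[OF assms(1) is_group assms(3)] by blast
next
  assume "s \<otimes> inv t \<in> P"
  then have "s \<in> P #> t"
    using subgroup.rcos_module_rev[OF assms(1) is_group assms(3,2)] by blast
  then show "P #> s = P #> t"
    using repr_independence[OF _ assms(3,1)] by simp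
qed

text \<open>
  The part of Sylow's theorem on conjugates, for any subgroup \<open>P\<close> of index prime to \<open>p\<close>:
  \<open>Q\<close> acts on the cosets of \<open>P\<close>, its orbits have \<open>p\<close>-power size, and their sizes add up to
  a number prime to \<open>p\<close>. Hence some coset \<open>P g\<close> is fixed, which means \<open>g Q g\<^sup>-\<^sup>1 \<subseteq> P\<close>.
\<close>

lemma (in group) p_subgroup_conj_into:
  assumes fin: "finite (carrier G)" and p: "Factorial_Ring.prime p" and P: "subgroup P G"
    and ind: "\<not> p dvd card (rcosets P)" and Q: "subgroup Q G" and cQ: "card Q = p ^ b"
  shows "\<exists>g\<in>carrier G. \<forall>q\<in>Q. g \<otimes> q \<otimes> inv g \<in> P"
proof -
  define E where "E = rcosets P"
  \<comment> \<open>The inverse turns right multiplication into a left action.\<close>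
  define \<phi> where "\<phi> q = (\<lambda>C\<in>E. C #> inv q)" for q
  let ?Q = "G\<lparr>carrier := Q\<rparr>"
  have Qc: "q \<in> carrier G" if "q \<in> Q" for q using that Q by (rule subgroup.mem_carrier[rotated])
  have Pc: "P \<subseteq> carrier G" using P by (rule subgroup.subset)
  have E: "C \<in> E \<longleftrightarrow> (\<exists>t\<in>carrier G. C = P #> t)" for C by (auto simp: E_def RCOSETS_def)
  have cl: "C #> g \<in> E" if "C \<in> E" "g \<in> carrier G" for C g
    using that E coset_mult_assoc[OF Pc] by (metis m_closed)
  have EC: "C \<subseteq> carrier G" if "C \<in> E" for C
    using that E r_coset_subset_G[OF Pc] by auto
  have bij: "\<phi> q \<in> Bij E" if q: "q \<in> carrier G" for q
  proof -
    have "bij_betw (\<phi> q) E E"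
    proof (rule bij_betw_byWitness[where f' = "\<lambda>C. C #> q"])
      show "\<forall>C\<in>E. \<phi> q C #> q = C" using q EC by (simp add: \<phi>_def coset_mult_assoc)
      show "\<forall>C\<in>E. \<phi> q (C #> q) = C" using q EC cl by (simp add: \<phi>_def coset_mult_assoc)
      show "\<phi> q ` E \<subseteq> E" using q cl by (auto simp: \<phi>_def)
      show "(\<lambda>C. C #> q) ` E \<subseteq> E" using q cl by auto
    qed
    then show ?thesis by (simp add: Bij_def \<phi>_def)
  qed
  interpret A: group_action ?Q E \<phi>
  proof (rule group_action.intro, rule group_hom.intro)
    show "group ?Q" using subgroup_imp_group[OF Q] .
    show "group (BijGroup E)" by (rule group_BijGroup)
    show "group_hom_axioms ?Q (BijGroup E) \<phi>"
    proof (rule group_hom_axioms.intro, rule homI)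
      fix x assume "x \<in> carrier ?Q"
      then show "\<phi> x \<in> carrier (BijGroup E)" using bij Qc by (simp add: BijGroup_def)
    next
      fix x y assume "x \<in> carrier ?Q" "y \<in> carrier ?Q"
      then have xy: "x \<in> carrier G" "y \<in> carrier G" using Qc by auto
      have "\<phi> (x \<otimes> y) = compose E (\<phi> x) (\<phi> y)"
        using xy EC cl by (intro ext) (auto simp: \<phi>_def compose_def inv_mult_group coset_mult_assoc)
      then show "\<phi> (x \<otimes>\<^bsub>?Q\<^esub> y) = \<phi> x \<otimes>\<^bsub>BijGroup E\<^esub> \<phi> y"
        using bij xy by (simp add: BijGroup_def)
    qed
  qed
  have finE: "finite E"
    using rcosets_subset_PowG[OF P] fin E_def by (metis finite_Pow_iff finite_subset)
  have "(\<Sum>orb\<in>orbits ?Q E \<phi>. card orb) = card E"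
    using A.disjoint_sum[OF finE, of "\<lambda>_. 1::nat"] by simp
  then obtain orb where orb: "orb \<in> orbits ?Q E \<phi>" "\<not> p dvd card orb"
    using ind by (metis E_def dvd_sum)
  then obtain C where C: "C \<in> E" "orb = orbit ?Q \<phi> C" by (auto simp: orbits_def)
  have "card orb dvd p ^ b"
    using A.orbit_stabilizer_theorem[OF C(1)] C(2) cQ by (simp add: order_def) (metis dvd_triv_left)
  then obtain i where i: "card orb = p ^ i" using p divides_primepow_nat by blast
  then have "i = 0" using orb(2) by (cases i) auto
  then have "card orb = 1" using i by simp
  then obtain D where "orb = {D}" by (auto simp: card_1_singleton_iff)
  then have "orb = {C}" using A.orbit_refl[OF C(1)] C(2) by auto
  then have fix0: "C #> inv q = C" if "q \<in> Q" for q
  proof -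
    have "\<phi> q C \<in> orb" using that C(2) by (auto simp: orbit_def)
    then show ?thesis using \<open>orb = {C}\<close> C(1) by (simp add: \<phi>_def)
  qed
  obtain t where t: "t \<in> carrier G" "C = P #> t" using C(1) E by blast
  have "t \<otimes> q \<otimes> inv t \<in> P" if q: "q \<in> Q" for q
  proof -
    have "inv q \<in> Q" using subgroup.m_inv_closed[OF Q q] .
    from fix0[OF this] have "P #> (t \<otimes> q) = P #> t"
      using q Qc t by (simp add: coset_mult_assoc[OF Pc])
    then show ?thesis using rcoset_eq_iff[OF P] q Qc t by simp
  qed
  then show ?thesis using t(1) by blast
qed

section \<open>Groups with cyclic Sylow subgroups\<close>

text \<open>
  For finite groups this is equivalent to all Sylow subgroups being cyclic, but it visibly
  passes to subgroups. Generation by powers with natural exponents is enough because all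
  elements have finite order.
\<close>

definition p_subgroups_cyclic :: "('a, 'b) monoid_scheme \<Rightarrow> bool" where
  "p_subgroups_cyclic G \<longleftrightarrow>
    (\<forall>p a P. Factorial_Ring.prime p \<longrightarrow> subgroup P G \<longrightarrow> card P = p ^ a \<longrightarrow>
      (\<exists>x\<in>P. \<forall>y\<in>P. \<exists>i::nat. y = x [^]\<^bsub>G\<^esub> i))"

lemma (in group) p_subgroups_cyclic_subgroup:
  assumes "p_subgroups_cyclic G" "subgroup K G"
  shows "p_subgroups_cyclic (G\<lparr>carrier := K\<rparr>)"
  unfolding p_subgroups_cyclic_def
proof (intro allI impI)
  fix p a P
  assume "Factorial_Ring.prime (p::nat)" and P: "subgroup P (G\<lparr>carrier := K\<rparr>)" and "card P = p ^ a"
  moreover have "subgroup P G" using incl_subgroup[OF assms(2) P] .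
  ultimately show "\<exists>x\<in>P. \<forall>y\<in>P. \<exists>i::nat. y = x [^]\<^bsub>G\<lparr>carrier := K\<rparr>\<^esub> i"
    using assms(1) nat_pow_consistent unfolding p_subgroups_cyclic_def by metis
qed

lemma (in group) subgroup_nat_pow_closed:
  assumes "subgroup K G" "x \<in> K" shows "x [^] (n::nat) \<in> K"
  using assms by (induction n) (auto simp: subgroup.one_closed subgroup.m_closed)

text \<open>
  Subgroups of cyclic groups are cyclic: the power of \<open>x\<close> with the least positive exponent
  that lies in \<open>Q\<close> generates \<open>Q\<close>, by division with remainder.
\<close>

lemma (in group) subgroup_of_powers:
  assumes fin: "finite (carrier G)" and x: "x \<in> carrier G" and Q: "subgroup Q G"
    and sub: "\<And>q. q \<in> Q \<Longrightarrow> \<exists>i::nat. q = x [^] i"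
  shows "\<exists>y\<in>Q. \<forall>q\<in>Q. \<exists>i::nat. q = y [^] i"
proof -
  define j where "j = (LEAST j::nat. j > 0 \<and> x [^] j \<in> Q)"
  have "\<exists>j::nat. j > 0 \<and> x [^] j \<in> Q"
    using pow_order_eq_1[OF x] fin order_gt_0_iff_finite subgroup.one_closed[OF Q] by metis
  then have j: "j > 0" "x [^] j \<in> Q" unfolding j_def by (metis (mono_tags, lifting) LeastI_ex)+
  have min: "i = 0" if "i < j" "x [^] i \<in> Q" for i
    using that not_less_Least[of i "\<lambda>j. j > 0 \<and> x [^] j \<in> Q"] unfolding j_def by auto
  have "\<exists>i::nat. q = (x [^] j) [^] i" if q: "q \<in> Q" for q
  proof -
    obtain n :: nat where n: "q = x [^] n" using sub q by blast
    have eq: "x [^] n = (x [^] j) [^] (n div j) \<otimes> x [^] (n mod j)"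
      using x by (simp add: nat_pow_pow nat_pow_mult)
    then have "x [^] (n mod j) = inv ((x [^] j) [^] (n div j)) \<otimes> q"
      using x n by (simp add: inv_solve_left)
    also have "\<dots> \<in> Q"
      using subgroup_nat_pow_closed[OF Q j(2)] q Q
      by (simp add: subgroup.m_closed subgroup.m_inv_closed)
    finally have "n mod j = 0" using min j(1) by simp
    then show ?thesis using eq n x by auto
  qed
  then show ?thesis using j(2) by blast
qed

lemma (in group) obtain_sylow:
  assumes fin: "finite (carrier G)" and p: "Factorial_Ring.prime p"
  obtains P where "subgroup P G" "card P = p ^ multiplicity p (Coset.order G)"
    "\<not> p dvd card (rcosets P)"
proof -
  define m where "m = multiplicity p (Coset.order G)"
  have o: "Coset.order G \<noteq> 0" using fin order_gt_0_iff_finite by simp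
  have "p ^ m dvd Coset.order G" unfolding m_def by (rule multiplicity_dvd)
  then obtain r where r: "Coset.order G = p ^ m * r" by blast
  obtain P where P: "subgroup P G" "card P = p ^ m"
    using sylow_thm[OF p is_group r fin] by blast
  have "card (rcosets P) * card P = p ^ m * r" using lagrange[OF P(1)] r by simp
  then have "card (rcosets P) = r" using P(2) p by (simp add: prime_gt_0_nat)
  moreover have "\<not> p dvd r"
  proof
    assume "p dvd r"
    then have "p ^ Suc m dvd Coset.order G" using r by (simp add: mult_dvd_mono)
    then show False using o p by (metis Suc_n_not_le_n m_def multiplicity_geI not_prime_unit)
  qed
  ultimately show thesis using that P m_def by simp
qed

text \<open>
  A \<open>p\<close>-subgroup is conjugate to a subgroup of a Sylow subgroup \<open>\<langle>x\<rangle>\<close>, so it is itself a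
  subgroup of a conjugate of \<open>\<langle>x\<rangle>\<close>.
\<close>

lemma (in group) p_subgroups_cyclicI:
  assumes fin: "finite (carrier G)"
    and syl: "\<And>p P. sylow_subgroup p P G \<Longrightarrow> cyclic_group (G\<lparr>carrier := P\<rparr>)"
  shows "p_subgroups_cyclic G"
  unfolding p_subgroups_cyclic_def
proof (intro allI impI)
  fix p a Q
  assume p: "Factorial_Ring.prime (p::nat)" and Q: "subgroup Q G" and cQ: "card Q = p ^ a"
  obtain P where P: "subgroup P G" "card P = p ^ multiplicity p (Coset.order G)"
    and ind: "\<not> p dvd card (rcosets P)"
    using obtain_sylow[OF fin p] .
  then have "sylow_subgroup p P G" using p by (simp add: sylow_subgroup_def)
  then have cyc: "cyclic_group (G\<lparr>carrier := P\<rparr>)" by (rule syl)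
  interpret P: group "G\<lparr>carrier := P\<rparr>" using subgroup_imp_group[OF P(1)] .
  obtain x where x: "x \<in> P" and "P = range (\<lambda>n::int. x [^]\<^bsub>G\<lparr>carrier := P\<rparr>\<^esub> n)"
    using cyc P.cyclic_group by auto
  then have gen: "P = range (\<lambda>n::int. x [^] n)"
    by (simp flip: int_pow_consistent[OF P(1)])
  have xG: "x \<in> carrier G" using subgroup.mem_carrier[OF P(1) x] .
  have gen': "\<exists>i::nat. y = x [^] i" if y: "y \<in> P" for y
  proof -
    obtain n :: int where n: "y = x [^] n" using y gen by blast
    have pos: "ord x > 0" using ord_ge_1[OF fin xG] by simp
    have "n mod int (ord x) - n = int (ord x) * (- (n div int (ord x)))"
      using mult_div_mod_eq[of "int (ord x)" n] by (simp only: mult_minus_right)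
    then have "y = x [^] (n mod int (ord x))"
      unfolding n by (simp only: int_pow_eq[OF xG] dvd_triv_left)
    moreover have "n mod int (ord x) = int (nat (n mod int (ord x)))"
      using pos by simp
    ultimately show ?thesis by (metis int_pow_int)
  qed
  obtain g where g: "g \<in> carrier G" "\<forall>q\<in>Q. g \<otimes> q \<otimes> inv g \<in> P"
    using p_subgroup_conj_into[OF fin p P(1) ind Q cQ] by blast
  show "\<exists>y\<in>Q. \<forall>q\<in>Q. \<exists>i::nat. q = y [^] i"
  proof (rule subgroup_of_powers[OF fin _ Q])
    show "inv g \<otimes> x \<otimes> g \<in> carrier G" using g xG by simp
    fix q assume q: "q \<in> Q"
    then have qG: "q \<in> carrier G" using subgroup.mem_carrier[OF Q] by simp
    obtain i :: nat where "g \<otimes> q \<otimes> inv g = x [^] i" using g q gen' by blast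
    then have "inv g \<otimes> x [^] i \<otimes> g = inv g \<otimes> (g \<otimes> q \<otimes> inv g) \<otimes> g" by simp
    also have "\<dots> = (inv g \<otimes> g) \<otimes> q \<otimes> (inv g \<otimes> g)" using g qG by (simp only: m_assoc inv_closed m_closed)
    also have "\<dots> = q" using g qG by simp
    finally have "q = (inv g \<otimes> x \<otimes> g) [^] i"
      using conj_nat_pow[of "inv g" x i] g xG by simp
    then show "\<exists>i::nat. q = (inv g \<otimes> x \<otimes> g) [^] i" by blast
  qed
qed

text \<open>
  The Sylow subgroups have order 1 or a prime.
\<close>

lemma (in group) squarefree_order_sylow_cyclic:
  assumes fin: "finite (carrier G)" and sq: "squarefree (Coset.order G)"
    and syl: "sylow_subgroup p P G"
  shows "cyclic_group (G\<lparr>carrier := P\<rparr>)"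
proof -
  have p: "Factorial_Ring.prime p" and P: "subgroup P G"
    and cP: "card P = p ^ multiplicity p (Coset.order G)"
    using syl by (auto simp: sylow_subgroup_def)
  interpret P: group "G\<lparr>carrier := P\<rparr>" using subgroup_imp_group[OF P] .
  have finP: "finite P" using P fin by (meson finite_subset subgroup.subset)
  have "Coset.order G \<noteq> 0" using fin order_gt_0_iff_finite by simp
  then have m1: "multiplicity p (Coset.order G) \<le> 1"
    using sq p by (simp add: squarefree_factorial_semiring'')
  show ?thesis
  proof (cases "multiplicity p (Coset.order G) = 0")
    case True
    then have "card P = 1" using cP by simp
    then have "trivial_group (G\<lparr>carrier := P\<rparr>)"
      by (auto simp: P.trivial_group card_1_singleton_iff)
    then show ?thesis by (rule trivial_imp_cyclic_group)
  next
    case False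
    then have cP: "card P = p" using m1 cP by (simp add: le_Suc_eq)
    have "P \<noteq> {\<one>}" using cP p not_prime_1 by (metis card_1_singleton_iff One_nat_def)
    then obtain x where x: "x \<in> P" "x \<noteq> \<one>" using P.one_closed by auto
    have "P.ord x dvd p" using P.ord_dvd_group_order[of x] x cP by (simp add: order_def)
    moreover have "P.ord x \<noteq> 1" using P.ord_eq_1[of x] x by simp
    ultimately have "P.ord x = p" using p by (metis prime_nat_iff)
    then have "card (generate (G\<lparr>carrier := P\<rparr>) {x}) = card P"
      using P.generate_pow_card[of x] x cP by simp
    moreover have "generate (G\<lparr>carrier := P\<rparr>) {x} \<subseteq> P"
      using P.generate_incl[of "{x}"] x by simp
    ultimately have "generate (G\<lparr>carrier := P\<rparr>) {x} = P"
      using finP by (metis card_subset_eq)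
    then have "P = range (\<lambda>k::int. x [^]\<^bsub>G\<lparr>carrier := P\<rparr>\<^esub> k)"
      using P.generate_pow[of x] x(1) by (simp add: full_SetCompr_eq)
    then show ?thesis
      unfolding P.cyclic_group using x(1) by (intro bexI[of _ x]) simp_all
  qed
qed

lemma (in group) nat_pow_mod:
  assumes x: "x \<in> carrier G" and 1: "x [^] (n::nat) = \<one>" and c: "[i = j] (mod n)"
  shows "x [^] i = x [^] j"
proof -
  have "x [^] k = x [^] (k mod n)" for k :: nat
  proof -
    have "x [^] k = x [^] (n * (k div n)) \<otimes> x [^] (k mod n)"
      using x by (simp add: nat_pow_mult)
    also have "x [^] (n * (k div n)) = \<one>"
      using x 1 by (simp flip: nat_pow_pow)
    finally show ?thesis using x by simp
  qed
  then show ?thesis using c by (metis cong_def)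
qed

lemma (in group) coprime_pow_eq_one:
  assumes x: "x \<in> carrier G" and "x [^] (m::nat) = \<one>" "x [^] (n::nat) = \<one>" and "coprime m n"
  shows "x = \<one>"
proof -
  have "ord x dvd m" "ord x dvd n" using assms pow_eq_id by auto
  then have "ord x = 1" using assms(4) by (metis coprime_common_divisor_nat nat_dvd_1_iff_1)
  then show ?thesis using x ord_eq_1 by blast
qed

text \<open>
  In a nontrivial cyclic \<open>p\<close>-group \<open>\<langle>x\<rangle>\<close>, the element \<open>z\<close> generates the unique subgroup of
  order \<open>p\<close>. This subgroup contains every element killed by \<open>p\<close> and lies in every
  nontrivial subgroup. Statements about \<open>\<langle>x\<rangle>\<close> can therefore be decided at \<open>z\<close>.
\<close>

lemma (in group) cyclic_p_group_socle:
  assumes x: "x \<in> carrier G" and p: "Factorial_Ring.prime p" and o: "ord x = p ^ Suc a"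
    and z: "z = x [^] (p ^ a)"
  shows "z \<noteq> \<one>" and "z [^] p = \<one>"
    and "\<And>i. (x [^] (i::nat)) [^] p = \<one> \<Longrightarrow> \<exists>j::nat. x [^] i = z [^] j"
    and "\<And>i. x [^] (i::nat) \<noteq> \<one> \<Longrightarrow> \<exists>j::nat. z = (x [^] i) [^] j"
proof -
  have p0: "p > 1" using p prime_gt_1_nat by blast
  show "z \<noteq> \<one>"
  proof
    assume "z = \<one>"
    then have "p ^ Suc a dvd p ^ a" using x z o pow_eq_id by metis
    then show False using p0 by (metis Suc_n_not_le_n power_dvd_imp_le)
  qed
  show "z [^] p = \<one>"
    using x z o pow_eq_id[OF x] by (simp add: nat_pow_pow mult.commute)
  show "\<exists>j::nat. x [^] i = z [^] j" if "(x [^] i) [^] p = \<one>" for i :: nat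
  proof -
    have "p ^ Suc a dvd i * p" using that x o pow_eq_id[OF x] by (simp add: nat_pow_pow)
    then have "p ^ a dvd i" using p0 by (simp add: mult.commute)
    then obtain j where "i = p ^ a * j" by blast
    then show ?thesis using x z by (auto simp: nat_pow_pow)
  qed
  show "\<exists>j::nat. z = (x [^] i) [^] j" if n1: "x [^] i \<noteq> \<one>" for i :: nat
  proof -
    have ndvd: "\<not> p ^ Suc a dvd i" using n1 o pow_eq_id[OF x] by simp
    \<comment> \<open>By Bezout, the subgroup generated by \<open>x [^] i\<close> contains \<open>x [^] (p ^ l)\<close>, and \<open>l \<le> a\<close>.\<close>
    obtain l where l: "l \<le> Suc a" "gcd i (p ^ Suc a) = p ^ l"
      using p divides_primepow_nat[of p "gcd i (p ^ Suc a)" "Suc a"] by auto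
    have "l \<noteq> Suc a" using ndvd l(2) by (metis gcd_dvd1)
    then have la: "l \<le> a" using l(1) by simp
    have "i \<noteq> 0" using ndvd by (metis dvd_0_right)
    then obtain y where "[i * y = p ^ l] (mod p ^ Suc a)" using cong_solve_nat l(2) by metis
    then have "[i * y * p ^ (a - l) = p ^ l * p ^ (a - l)] (mod p ^ Suc a)" by (rule cong_scalar_right)
    moreover have "p ^ l * p ^ (a - l) = p ^ a" using la by (simp flip: power_add)
    ultimately have "x [^] (i * y * p ^ (a - l)) = x [^] (p ^ a)"
      using nat_pow_mod[OF x] o x by (metis pow_ord_eq_1)
    then have "z = (x [^] i) [^] (y * p ^ (a - l))"
      using x z by (simp add: nat_pow_pow mult.assoc)
    then show ?thesis by blast
  qed
qed

lemma (in group) card_powers: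
  assumes P: "subgroup P G" and xP: "x \<in> P" and gen: "\<And>y. y \<in> P \<Longrightarrow> \<exists>i::nat. y = x [^] i"
  shows "card P = ord x"
proof -
  have x: "x \<in> carrier G" using subgroup.mem_carrier[OF P xP] .
  have "P = generate G {x}"
  proof
    show "P \<subseteq> generate G {x}"
      using gen generate_pow[OF x] by (auto simp flip: int_pow_int)
    show "generate G {x} \<subseteq> P" using xP by (intro generate_subgroup_incl[OF _ P]) simp
  qed
  then show ?thesis using generate_pow_card[OF x] by simp
qed

lemma (in group) powers_comm_group:
  assumes P: "subgroup P G" and xP: "x \<in> P" and gen: "\<And>y. y \<in> P \<Longrightarrow> \<exists>i::nat. y = x [^] i"
  shows "comm_group (G\<lparr>carrier := P\<rparr>)"
proof (rule group.group_comm_groupI[OF subgroup_imp_group[OF P]])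
  fix y w assume "y \<in> carrier (G\<lparr>carrier := P\<rparr>)" "w \<in> carrier (G\<lparr>carrier := P\<rparr>)"
  then obtain i j :: nat where "y = x [^] i" "w = x [^] j" using gen by auto metis
  then show "y \<otimes>\<^bsub>G\<lparr>carrier := P\<rparr>\<^esub> w = w \<otimes>\<^bsub>G\<lparr>carrier := P\<rparr>\<^esub> y"
    using subgroup.mem_carrier[OF P xP] by (simp add: nat_pow_mult add.commute)
qed

section \<open>Transfer into a cyclic Sylow subgroup\<close>

text \<open>
  The transfer of \<open>G\<close> into an abelian subgroup \<open>P\<close>, computed with the transversal \<open>\<tau>\<close> of
  the right cosets of \<open>P\<close>. It is a homomorphism for every \<open>\<tau>\<close>, so that \<open>\<tau>\<close> may be adapted
  to the element at which it is evaluated.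
\<close>

definition transfer :: "('a, 'b) monoid_scheme \<Rightarrow> 'a set \<Rightarrow> ('a set \<Rightarrow> 'a) \<Rightarrow> 'a \<Rightarrow> 'a" where
  "transfer G P \<tau> g =
    finprod (G\<lparr>carrier := P\<rparr>) (\<lambda>C. \<tau> C \<otimes>\<^bsub>G\<^esub> g \<otimes>\<^bsub>G\<^esub> inv\<^bsub>G\<^esub> \<tau> (C #>\<^bsub>G\<^esub> g)) (rcosets\<^bsub>G\<^esub> P)"

lemma (in group) rcosets_rep:
  assumes P: "subgroup P G" and C: "C \<in> rcosets P" and t: "t \<in> C"
  shows "t \<in> carrier G" "C = P #> t"
proof -
  obtain s where s: "s \<in> carrier G" "C = P #> s" using C by (auto simp: RCOSETS_def)
  then show "t \<in> carrier G" "C = P #> t"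
    using t repr_independence[OF _ s(1) P] r_coset_subset_G[OF subgroup.subset[OF P] s(1)] by auto
qed

lemma (in group) rcosets_mult_closed:
  assumes P: "subgroup P G" and C: "C \<in> rcosets P" and g: "g \<in> carrier G"
  shows "C #> g \<in> rcosets P"
  using C g coset_mult_assoc[OF subgroup.subset[OF P]] by (auto simp: RCOSETS_def)

lemma (in group) transfer_factor:
  assumes P: "subgroup P G" and \<tau>: "\<And>C. C \<in> rcosets P \<Longrightarrow> \<tau> C \<in> C"
    and C: "C \<in> rcosets P" and g: "g \<in> carrier G"
  shows "\<tau> C \<otimes> g \<otimes> inv \<tau> (C #> g) \<in> P"
proof -
  note c = rcosets_rep[OF P C \<tau>[OF C]]
  have Cg: "C #> g \<in> rcosets P" using rcosets_mult_closed[OF P C g] .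
  note cg = rcosets_rep[OF P Cg \<tau>[OF Cg]]
  have "P #> (\<tau> C \<otimes> g) = C #> g"
    using c g coset_mult_assoc[OF subgroup.subset[OF P] c(1) g] by simp
  then have "P #> (\<tau> C \<otimes> g) = P #> \<tau> (C #> g)" using cg(2) by simp
  then show ?thesis using rcoset_eq_iff[OF P] c(1) cg(1) g by simp
qed

text \<open>
  The factors satisfy the cocycle identity \<open>\<pi> (g h) C = \<pi> g C \<otimes> \<pi> h (C g)\<close>, and \<open>C \<mapsto> C g\<close>
  permutes the cosets.
\<close>

lemma (in group) transfer_hom:
  assumes P: "subgroup P G" and comm: "comm_group (G\<lparr>carrier := P\<rparr>)"
    and \<tau>: "\<And>C. C \<in> rcosets P \<Longrightarrow> \<tau> C \<in> C"
  shows "transfer G P \<tau> \<in> hom G (G\<lparr>carrier := P\<rparr>)"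
proof -
  interpret P: comm_group "G\<lparr>carrier := P\<rparr>" by (rule comm)
  let ?\<pi> = "\<lambda>g C. \<tau> C \<otimes> g \<otimes> inv \<tau> (C #> g)"
  have in_P: "?\<pi> g \<in> rcosets P \<rightarrow> carrier (G\<lparr>carrier := P\<rparr>)" if "g \<in> carrier G" for g
    using transfer_factor[OF P \<tau>] that by auto
  show ?thesis
  proof (rule homI)
    fix g assume g: "g \<in> carrier G"
    show "transfer G P \<tau> g \<in> carrier (G\<lparr>carrier := P\<rparr>)"
      unfolding transfer_def by (rule P.finprod_closed[OF in_P[OF g]])
  next
    fix g h assume g: "g \<in> carrier G" and h: "h \<in> carrier G"
    have inj: "inj_on (\<lambda>C. C #> g) (rcosets P)"
    proof (rule inj_on_inverseI)
      fix C assume "C \<in> rcosets P"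
      then have "C \<subseteq> carrier G" using rcosets_subset_PowG[OF P] by auto
      then show "C #> g #> inv g = C" using g by (simp add: coset_mult_assoc)
    qed
    have sub: "(\<lambda>C. C #> g) ` (rcosets P) \<subseteq> rcosets P"
      using rcosets_mult_closed[OF P _ g] by auto
    have im: "(\<lambda>C. C #> g) ` (rcosets P) = rcosets P"
    proof
      show "rcosets P \<subseteq> (\<lambda>C. C #> g) ` (rcosets P)"
      proof
        fix C assume C: "C \<in> rcosets P"
        then have "C \<subseteq> carrier G" using rcosets_subset_PowG[OF P] by auto
        then have "C = (C #> inv g) #> g" using g by (simp add: coset_mult_assoc)
        then show "C \<in> (\<lambda>C. C #> g) ` (rcosets P)"
          using rcosets_mult_closed[OF P C] g by blast
      qed
    qed (rule sub)
    have "transfer G P \<tau> (g \<otimes> h) =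
        finprod (G\<lparr>carrier := P\<rparr>) (\<lambda>C. ?\<pi> g C \<otimes>\<^bsub>G\<lparr>carrier := P\<rparr>\<^esub> ?\<pi> h (C #> g)) (rcosets P)"
      unfolding transfer_def
    proof (rule P.finprod_cong')
      fix C assume C: "C \<in> rcosets P"
      note c = rcosets_rep(1)[OF P C \<tau>[OF C]]
      have Cg: "C #> g \<in> rcosets P" using rcosets_mult_closed[OF P C g] .
      note cg = rcosets_rep(1)[OF P Cg \<tau>[OF Cg]]
      have Cgh: "C #> g #> h \<in> rcosets P" using rcosets_mult_closed[OF P Cg h] .
      note cgh = rcosets_rep(1)[OF P Cgh \<tau>[OF Cgh]]
      have "C #> (g \<otimes> h) = C #> g #> h"
        using C g h rcosets_subset_PowG[OF P] by (subst coset_mult_assoc) auto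
      then show "?\<pi> (g \<otimes> h) C = ?\<pi> g C \<otimes>\<^bsub>G\<lparr>carrier := P\<rparr>\<^esub> ?\<pi> h (C #> g)"
        using c cg cgh g h by (simp add: m_assoc cancel_inv)
    next
      show "(\<lambda>C. ?\<pi> g C \<otimes>\<^bsub>G\<lparr>carrier := P\<rparr>\<^esub> ?\<pi> h (C #> g))
        \<in> rcosets P \<rightarrow> carrier (G\<lparr>carrier := P\<rparr>)"
      proof
        fix C assume C: "C \<in> rcosets P"
        have Cg: "C #> g \<in> rcosets P" using rcosets_mult_closed[OF P C g] .
        show "?\<pi> g C \<otimes>\<^bsub>G\<lparr>carrier := P\<rparr>\<^esub> ?\<pi> h (C #> g) \<in> carrier (G\<lparr>carrier := P\<rparr>)"
          using funcset_mem[OF in_P[OF g] C] funcset_mem[OF in_P[OF h] Cg] by (rule P.m_closed)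
      qed
    qed simp
    also have "\<dots> = finprod (G\<lparr>carrier := P\<rparr>) (?\<pi> g) (rcosets P)
        \<otimes>\<^bsub>G\<lparr>carrier := P\<rparr>\<^esub> finprod (G\<lparr>carrier := P\<rparr>) (\<lambda>C. ?\<pi> h (C #> g)) (rcosets P)"
      using in_P[OF g] funcset_mem[OF in_P[OF h]] sub
      by (intro P.finprod_multf) (auto simp: Pi_def image_subset_iff)
    also have "finprod (G\<lparr>carrier := P\<rparr>) (\<lambda>C. ?\<pi> h (C #> g)) (rcosets P)
        = finprod (G\<lparr>carrier := P\<rparr>) (?\<pi> h) ((\<lambda>C. C #> g) ` (rcosets P))"
      using in_P[OF h] inj im by (intro P.finprod_reindex[symmetric]) auto
    finally show "transfer G P \<tau> (g \<otimes> h) =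
        transfer G P \<tau> g \<otimes>\<^bsub>G\<lparr>carrier := P\<rparr>\<^esub> transfer G P \<tau> h"
      unfolding im transfer_def .
  qed
qed

lemma (in group) rcoset_fixed_power:
  assumes "C \<subseteq> carrier G" "w \<in> carrier G" "C #> w = C"
  shows "C #> w [^] (n::nat) = C"
proof (induction n)
  case (Suc n)
  have "C #> w [^] Suc n = C #> w [^] n #> w"
    using assms by (simp add: coset_mult_assoc)
  then show ?case using Suc assms by simp
qed (use assms in simp)

text \<open>
  As \<open>z\<close> has order dividing the prime \<open>p\<close>, it acts freely on the orbits where it moves a
  coset. On such an orbit one representative \<open>r\<close> can be moved along the orbit without
  ambiguity. With this transversal the moved cosets contribute trivially to the transfer
  of \<open>z\<close>.
\<close>

lemma (in group) equivariant_transversal: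
  fixes p :: nat
  assumes P: "subgroup P G" and p: "Factorial_Ring.prime p"
    and z: "z \<in> carrier G" "z [^] p = \<one>"
  obtains \<tau> where "\<And>C. C \<in> rcosets P \<Longrightarrow> \<tau> C \<in> C"
    and "\<And>C. C \<in> rcosets P \<Longrightarrow> C #> z \<noteq> C \<Longrightarrow> \<tau> (C #> z) = \<tau> C \<otimes> z"
proof -
  define E where "E = rcosets P"
  define orb where "orb C = {C #> z [^] i | i::nat. True}" for C
  define rep where "rep C = (SOME D. D \<in> orb C)" for C
  define idx where "idx C = (SOME i::nat. C = rep C #> z [^] i)" for C
  define \<tau> where "\<tau> C = (SOME t. t \<in> rep C) \<otimes> z [^] idx C" for C
  have p1: "p \<ge> 1" using p prime_gt_1_nat[of p] by simp
  have sub: "C \<subseteq> carrier G" if "C \<in> E" for C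
    using that rcosets_subset_PowG[OF P] E_def by auto
  have cl: "C #> g \<in> E" if "C \<in> E" "g \<in> carrier G" for C g
    using rcosets_mult_closed[OF P] that E_def by simp
  have pp: "C #> z [^] (i::nat) #> z [^] (j::nat) = C #> z [^] (i + j)" if "C \<in> E" for C i j
    using sub[OF that] z by (simp add: coset_mult_assoc nat_pow_mult)
  have zp: "z [^] (p * i) = \<one>" for i :: nat using z by (simp flip: nat_pow_pow)
  have rep: "rep C \<in> orb C" for C unfolding rep_def orb_def by (rule someI) blast
  have repE: "rep C \<in> E" if C: "C \<in> E" for C
    using rep[of C] cl[OF C] z by (auto simp: orb_def)
  have idx: "C = rep C #> z [^] idx C" if C: "C \<in> E" for C
  proof -
    obtain j :: nat where j: "rep C = C #> z [^] j" using rep[of C] by (auto simp: orb_def)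
    have "rep C #> z [^] ((p - 1) * j) = C #> z [^] (p * j)"
      using pp[OF C] p1 j by (simp add: algebra_simps)
    then have "C = rep C #> z [^] ((p - 1) * j)" using zp sub[OF C] by simp
    then show ?thesis unfolding idx_def by (rule someI)
  qed
  have orb_z: "orb (C #> z) = orb C" if C: "C \<in> E" for C
  proof -
    have *: "C #> z #> z [^] i = C #> z [^] (1 + i)" for i :: nat
      using pp[OF C, of 1 i] z by simp
    have "C #> z [^] i \<in> orb (C #> z)" for i :: nat
    proof -
      have "C #> z #> z [^] (i + (p - 1)) = C #> z [^] (1 + (i + (p - 1)))" by (rule *)
      also have "1 + (i + (p - 1)) = i + p * 1" using p1 by simp
      also have "C #> z [^] (i + p * 1) = C #> z [^] i #> z [^] (p * 1)" by (rule pp[OF C, symmetric])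
      also have "\<dots> = C #> z [^] i" using zp sub[OF cl[OF C]] z by simp
      finally show ?thesis unfolding orb_def by (metis (mono_tags, lifting) mem_Collect_eq)
    qed
    then show ?thesis using * unfolding orb_def by blast
  qed
  have some: "(SOME t. t \<in> D) \<in> D" if "D \<in> E" for D
    using that subgroup.rcosets_non_empty[OF P] E_def by (simp add: some_in_eq)
  have 1: "\<tau> C \<in> C" if C: "C \<in> E" for C
  proof -
    have "\<tau> C \<in> rep C #> z [^] idx C"
      unfolding \<tau>_def r_coset_def using some[OF repE[OF C]] by blast
    then show ?thesis using idx[OF C] by simp
  qed
  have 2: "\<tau> (C #> z) = \<tau> C \<otimes> z" if C: "C \<in> E" and ne: "C #> z \<noteq> C" for C
  proof -
    let ?r = "rep C"
    have rE: "?r \<in> E" by (rule repE[OF C])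
    have r': "rep (C #> z) = ?r" unfolding rep_def orb_z[OF C] ..
    define i where "i = idx C"
    define j where "j = idx (C #> z)"
    have "?r #> z [^] j = C #> z" using idx[OF cl[OF C z(1)]] r' j_def by simp
    also have "\<dots> = ?r #> z [^] i #> z" using idx[OF C] i_def by simp
    also have "\<dots> = ?r #> z [^] (i + 1)" using pp[OF rE, of i 1] z by simp
    finally have eq: "?r #> z [^] j = ?r #> z [^] (i + 1)" .
    \<comment> \<open>Two ways to reach the same coset from \<open>?r\<close> use the same power of \<open>z\<close>: otherwise a nontrivial
    power of \<open>z\<close>, hence also \<open>z\<close> itself, would fix \<open>?r\<close> and therefore \<open>C\<close>.\<close>
    have "z [^] j = z [^] (i + 1)"
    proof (rule ccontr)
      assume neq: "z [^] j \<noteq> z [^] (i + 1)"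
      define d where "d = j + (p - 1) * (i + 1)"
      have d': "d + (i + 1) = j + p * (i + 1)"
        unfolding d_def using p1 by (cases p) (simp_all add: algebra_simps)
      have "?r #> z [^] d = ?r #> z [^] (i + 1) #> z [^] ((p - 1) * (i + 1))"
        unfolding d_def using pp[OF rE] eq by metis
      also have "\<dots> = ?r #> z [^] (i + 1 + (p - 1) * (i + 1))" by (rule pp[OF rE])
      also have "i + 1 + (p - 1) * (i + 1) = p * (i + 1)" using p1 by (cases p) simp_all
      finally have fixd: "?r #> z [^] d = ?r" using sub[OF rE] by (simp only: zp coset_mult_one)
      have "\<not> p dvd d"
      proof
        assume "p dvd d"
        then obtain k where "d = p * k" by blast
        then have "z [^] d = \<one>" using zp by simp
        then have "z [^] (d + (i + 1)) = z [^] (i + 1)" using z by (simp flip: nat_pow_mult)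
        moreover have "z [^] (j + p * (i + 1)) = z [^] j"
          using z zp by (simp flip: nat_pow_mult)
        ultimately show False using neq unfolding d' by metis
      qed
      then have "coprime d p" using p by (metis coprime_commute prime_imp_coprime)
      then obtain e where e: "[d * e = 1] (mod p)" using cong_solve_coprime_nat by (metis One_nat_def)
      have "z [^] (d * e) = z" using nat_pow_mod[OF z e] z by simp
      moreover have "?r #> (z [^] d) [^] e = ?r"
        using rcoset_fixed_power[OF sub[OF rE] _ fixd] z by simp
      ultimately have rz: "?r #> z = ?r" using z by (simp add: nat_pow_pow)
      have "C #> z = ?r" using idx[OF cl[OF C z(1)]] r' rcoset_fixed_power[OF sub[OF rE] z(1) rz] by simp
      moreover have "C = ?r" using idx[OF C] rcoset_fixed_power[OF sub[OF rE] z(1) rz] by simp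
      ultimately show False using ne by simp
    qed
    then have "z [^] j = z [^] i \<otimes> z" by simp
    then show ?thesis
      using some[OF rE] sub[OF rE] z unfolding \<tau>_def r' i_def j_def by (auto simp: m_assoc)
  qed
  show thesis using that[of \<tau>] 1 2 E_def by blast
qed

section \<open>Sylow subgroups and the derived subgroup\<close>

lemma (in group) centralizer_subgroup:
  assumes z: "z \<in> carrier G"
  shows "subgroup {t \<in> carrier G. t \<otimes> z = z \<otimes> t} G"
proof (rule subgroupI)
  show "{t \<in> carrier G. t \<otimes> z = z \<otimes> t} \<noteq> {}" using z by force
next
  fix a assume "a \<in> {t \<in> carrier G. t \<otimes> z = z \<otimes> t}"
  then have a: "a \<in> carrier G" "a \<otimes> z = z \<otimes> a" by auto
  have "inv a \<otimes> z = inv a \<otimes> (z \<otimes> a) \<otimes> inv a" using a(1) z by (simp add: m_assoc)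
  also have "\<dots> = z \<otimes> inv a" using a z by (simp flip: a(2) add: cancel_inv)
  finally show "inv a \<in> {t \<in> carrier G. t \<otimes> z = z \<otimes> t}" using a by simp
next
  fix a b assume "a \<in> {t \<in> carrier G. t \<otimes> z = z \<otimes> t}" "b \<in> {t \<in> carrier G. t \<otimes> z = z \<otimes> t}"
  then have ab: "a \<in> carrier G" "a \<otimes> z = z \<otimes> a" "b \<in> carrier G" "b \<otimes> z = z \<otimes> b" by auto
  have "a \<otimes> b \<otimes> z = a \<otimes> z \<otimes> b" using ab z by (metis m_assoc)
  also have "\<dots> = z \<otimes> a \<otimes> b" using ab(2) by simp
  also have "\<dots> = z \<otimes> (a \<otimes> b)" using ab z by (simp only: m_assoc)
  finally show "a \<otimes> b \<in> {t \<in> carrier G. t \<otimes> z = z \<otimes> t}" using ab by simp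
qed auto

lemma (in group) conj_eq_iff_commute:
  assumes "t \<in> carrier G" "z \<in> carrier G" "w \<in> carrier G"
  shows "t \<otimes> z \<otimes> inv t = w \<longleftrightarrow> t \<otimes> z = w \<otimes> t"
  using assms by (metis inv_solve_right m_closed)

lemma (in group) commutator_in_derived:
  assumes "a \<in> carrier G" "b \<in> carrier G"
  shows "a \<otimes> b \<otimes> inv a \<otimes> inv b \<in> derived G (carrier G)"
  unfolding derived_def using assms by (intro generate.incl) blast

text \<open>
  Homomorphisms into abelian groups kill commutators.
\<close>

lemma (in group) derived_le_kernel:
  assumes f: "f \<in> hom G A" and A: "comm_group A"
  shows "derived G (carrier G) \<subseteq> kernel G A f"
proof -
  interpret A: comm_group A by (rule A)
  interpret f: group_hom G A f using f by unfold_locales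
  have "derived_set G (carrier G) \<subseteq> kernel G A f"
  proof (clarify, unfold kernel_def, intro CollectI conjI)
    fix a b assume ab: "a \<in> carrier G" "b \<in> carrier G"
    then show "a \<otimes> b \<otimes> inv a \<otimes> inv b \<in> carrier G" by simp
    have "f (a \<otimes> b \<otimes> inv a \<otimes> inv b) = f b \<otimes>\<^bsub>A\<^esub> f a \<otimes>\<^bsub>A\<^esub> inv\<^bsub>A\<^esub> f a \<otimes>\<^bsub>A\<^esub> inv\<^bsub>A\<^esub> f b"
      using ab A.m_comm[of "f a" "f b"] by simp
    also have "\<dots> = \<one>\<^bsub>A\<^esub>" using ab by (simp add: A.m_assoc A.cancel_inv)
    finally show "f (a \<otimes> b \<otimes> inv a \<otimes> inv b) = \<one>\<^bsub>A\<^esub>" .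
  qed
  then show ?thesis
    unfolding derived_def using generate_subgroup_incl f.subgroup_kernel by blast
qed

text \<open>
  With the equivariant transversal, the transfer of \<open>z\<close> is the product of the conjugates
  of \<open>z\<close> belonging to the cosets fixed by \<open>z\<close>. By \<open>cent\<close> all of them equal \<open>z\<close>, and the
  fixed cosets are those inside the centralizer of \<open>z\<close>, so that their number is prime to
  \<open>p\<close>. Thus the transfer does not kill \<open>z\<close>, but it kills the derived subgroup.
\<close>

lemma (in group) transfer_socle:
  fixes p :: nat
  assumes fin: "finite (carrier G)" and p: "Factorial_Ring.prime p" and P: "subgroup P G"
    and ind: "\<not> p dvd card (rcosets P)" and comm: "comm_group (G\<lparr>carrier := P\<rparr>)"
    and zP: "z \<in> P" and z1: "z \<noteq> \<one>" and zp: "z [^] p = \<one>"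
    and cent: "\<And>t. t \<in> carrier G \<Longrightarrow> t \<otimes> z \<otimes> inv t \<in> P \<Longrightarrow> t \<otimes> z \<otimes> inv t = z"
  shows "z \<notin> derived G (carrier G)"
proof
  assume zD: "z \<in> derived G (carrier G)"
  have z: "z \<in> carrier G" using subgroup.mem_carrier[OF P zP] .
  interpret P: comm_group "G\<lparr>carrier := P\<rparr>" by (rule comm)
  obtain \<tau> where \<tau>: "\<And>C. C \<in> rcosets P \<Longrightarrow> \<tau> C \<in> C"
    and eq: "\<And>C. C \<in> rcosets P \<Longrightarrow> C #> z \<noteq> C \<Longrightarrow> \<tau> (C #> z) = \<tau> C \<otimes> z"
    using equivariant_transversal[OF P p z zp] by blast
  have finE: "finite (rcosets P)"
    using rcosets_subset_PowG[OF P] fin by (metis finite_Pow_iff finite_subset)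
  define F where "F = {C \<in> rcosets P. C #> z = C}"
  have "transfer G P \<tau> z = \<one>"
    using zD derived_le_kernel[OF transfer_hom[OF P comm \<tau>] comm] by (auto simp: kernel_def)
  moreover have "transfer G P \<tau> z = finprod (G\<lparr>carrier := P\<rparr>) (\<lambda>_. z) F"
    unfolding transfer_def
  proof (rule P.finprod_mono_neutral_cong_right[OF finE])
    show "F \<subseteq> rcosets P" by (auto simp: F_def)
    show "\<tau> C \<otimes> z \<otimes> inv \<tau> (C #> z) = \<one>\<^bsub>G\<lparr>carrier := P\<rparr>\<^esub>" if "C \<in> rcosets P - F" for C
    proof -
      have C: "C \<in> rcosets P" and "C #> z \<noteq> C" using that by (auto simp: F_def)
      then show ?thesis using eq[OF C] rcosets_rep(1)[OF P C \<tau>[OF C]] z by simp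
    qed
    show "\<tau> C \<otimes> z \<otimes> inv \<tau> (C #> z) = z" if "C \<in> F" for C
    proof -
      have C: "C \<in> rcosets P" and fix0: "C #> z = C" using that by (auto simp: F_def)
      show ?thesis
        using transfer_factor[OF P \<tau> C z] cent rcosets_rep(1)[OF P C \<tau>[OF C]] fix0 by simp
    qed
    show "(\<lambda>C. \<tau> C \<otimes> z \<otimes> inv \<tau> (C #> z)) \<in> rcosets P \<rightarrow> carrier (G\<lparr>carrier := P\<rparr>)"
      using transfer_factor[OF P \<tau> _ z] by simp
  qed
  moreover have "\<dots> = z [^] card F"
    using P.finprod_const[of z F] zP by (simp flip: nat_pow_consistent)
  ultimately have "z [^] card F = \<one>" by simp
  moreover have "coprime (card F) p"
  proof -
    define N where "N = {t \<in> carrier G. t \<otimes> z = z \<otimes> t}"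
    have N: "subgroup N G" unfolding N_def by (rule centralizer_subgroup[OF z])
    have PN: "P \<subseteq> N"
      using P.m_comm zP subgroup.mem_carrier[OF P] by (auto simp: N_def)
    interpret N: group "G\<lparr>carrier := N\<rparr>" using subgroup_imp_group[OF N] .
    have fixed: "(P #> t) #> z = P #> t \<longleftrightarrow> t \<in> N" if t: "t \<in> carrier G" for t
    proof -
      have "(P #> t) #> z = P #> t \<longleftrightarrow> t \<otimes> z \<otimes> inv t \<in> P"
        using t z rcoset_eq_iff[OF P] by (simp add: coset_mult_assoc[OF subgroup.subset[OF P]])
      also have "\<dots> \<longleftrightarrow> t \<otimes> z \<otimes> inv t = z" using cent t zP by auto
      also have "\<dots> \<longleftrightarrow> t \<in> N" using conj_eq_iff_commute t z by (simp add: N_def)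
      finally show ?thesis .
    qed
    have "F = rcosets\<^bsub>G\<lparr>carrier := N\<rparr>\<^esub> P"
      using fixed subgroup.mem_carrier[OF N] by (auto simp: F_def RCOSETS_def)
    then have "card F * card P = card N"
      using N.lagrange[of P] subgroup_incl[OF P N PN] by (simp add: order_def)
    moreover have "card N dvd order G" using lagrange[OF N] by (metis dvd_triv_right)
    ultimately have "card F * card P dvd card (rcosets P) * card P" using lagrange[OF P] by simp
    moreover have "card P > 0" using subgroup.finite_imp_card_positive[OF P fin] .
    ultimately have "card F dvd card (rcosets P)" by simp
    then have "\<not> p dvd card F" using ind dvd_trans by blast
    then show ?thesis using p by (metis coprime_commute prime_imp_coprime)
  qed
  ultimately have "z = \<one>" using coprime_pow_eq_one[OF z _ zp] by blast
  then show False using z1 by simp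
qed

lemma (in group) socle_conj:
  fixes p :: nat
  assumes p: "Factorial_Ring.prime p" and xP: "x \<in> P"
    and gen: "\<And>y. y \<in> P \<Longrightarrow> \<exists>i::nat. y = x [^] i"
    and o: "ord x = p ^ Suc a" and z: "z = x [^] (p ^ a)"
    and t: "t \<in> carrier G" and tP: "t \<otimes> z \<otimes> inv t \<in> P" and P: "subgroup P G"
  shows "\<exists>k::nat. t \<otimes> z \<otimes> inv t = z [^] k"
proof -
  have x: "x \<in> carrier G" using subgroup.mem_carrier[OF P xP] .
  have zG: "z \<in> carrier G" using z x by simp
  note soc = cyclic_p_group_socle[OF x p o z]
  have "(t \<otimes> z \<otimes> inv t) [^] p = \<one>" using conj_nat_pow[OF t zG] soc(2) t by simp
  moreover obtain i :: nat where i: "t \<otimes> z \<otimes> inv t = x [^] i" using gen[OF tP] by blast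
  ultimately have "\<exists>j::nat. x [^] i = z [^] j" by (intro soc(3)) simp
  then show ?thesis using i by auto
qed

text \<open>
  By a Frattini argument, \<open>t\<close> can be replaced by some \<open>s\<close> that normalizes \<open>P\<close> and acts in
  the same way on \<open>z\<close>: both \<open>P\<close> and \<open>t P t\<^sup>-\<^sup>1\<close> are Sylow subgroups of the centralizer of
  \<open>z\<close>, hence conjugate there. Then \<open>s x s\<^sup>-\<^sup>1 = x\<^sup>m\<close> with \<open>m\<close> not congruent to 1 modulo
  \<open>p\<close>, because \<open>s\<close> moves \<open>z\<close>, and the commutator \<open>x\<^sup>m\<^sup>-\<^sup>1\<close> of \<open>s\<close> and \<open>x\<close> generates \<open>P\<close>.
\<close>

lemma (in group) cyclic_sylow_le_derived:
  fixes p :: nat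
  assumes fin: "finite (carrier G)" and p: "Factorial_Ring.prime p" and P: "subgroup P G"
    and ind: "\<not> p dvd card (rcosets P)"
    and xP: "x \<in> P" and gen: "\<And>y. y \<in> P \<Longrightarrow> \<exists>i::nat. y = x [^] i"
    and o: "ord x = p ^ Suc a" and z: "z = x [^] (p ^ a)"
    and t: "t \<in> carrier G" and tP: "t \<otimes> z \<otimes> inv t \<in> P" and tz: "t \<otimes> z \<otimes> inv t \<noteq> z"
  shows "P \<subseteq> derived G (carrier G)"
proof -
  define D where "D = derived G (carrier G)"
  have D: "subgroup D G" unfolding D_def by (rule derived_is_subgroup) simp
  have x: "x \<in> carrier G" using subgroup.mem_carrier[OF P xP] .
  have zG: "z \<in> carrier G" using z x by simp
  note soc = cyclic_p_group_socle[OF x p o z]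
  define C where "C = {c \<in> carrier G. c \<otimes> z = z \<otimes> c}"
  have C: "subgroup C G" unfolding C_def by (rule centralizer_subgroup[OF zG])
  have PC: "P \<subseteq> C"
  proof
    fix y assume y: "y \<in> P"
    obtain i :: nat where "y = x [^] i" using gen[OF y] by blast
    then show "y \<in> C" using x z by (simp add: C_def nat_pow_mult add.commute)
  qed
  obtain k :: nat where k: "t \<otimes> z \<otimes> inv t = z [^] k"
    using socle_conj[OF p xP gen o z t tP] P by blast
  let ?Q = "(\<lambda>y. t \<otimes> y \<otimes> inv t) ` P"
  have Pc: "y \<in> carrier G" if "y \<in> P" for y using subgroup.mem_carrier[OF P that] .
  obtain l :: nat where l: "z = (z [^] k) [^] l"
  proof -
    have "z [^] k \<noteq> \<one>"
    proof
      assume "z [^] k = \<one>"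
      then have "t \<otimes> z = t" using k conj_eq_iff_commute[OF t zG, of \<one>] t by simp
      then show False using soc(1) t zG by simp
    qed
    then have "x [^] (p ^ a * k) \<noteq> \<one>" using x z by (simp flip: nat_pow_pow)
    then have "\<exists>j::nat. z = (x [^] (p ^ a * k)) [^] j" by (rule soc(4))
    then show thesis using that x z by (auto simp flip: nat_pow_pow)
  qed
  have QC: "?Q \<subseteq> C"
  proof (clarify)
    fix y assume y: "y \<in> P"
    have yz: "y \<otimes> z = z \<otimes> y" using PC y by (auto simp: C_def)
    have "(t \<otimes> y \<otimes> inv t) \<otimes> (t \<otimes> z \<otimes> inv t) = t \<otimes> (y \<otimes> z) \<otimes> inv t"
      using t zG Pc[OF y] by (simp add: m_assoc cancel_inv)
    also have "\<dots> = (t \<otimes> z \<otimes> inv t) \<otimes> (t \<otimes> y \<otimes> inv t)"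
      unfolding yz using t zG Pc[OF y] by (simp add: m_assoc cancel_inv)
    finally have "(z [^] k) \<otimes> (t \<otimes> y \<otimes> inv t) = (t \<otimes> y \<otimes> inv t) \<otimes> (z [^] k)"
      unfolding k by simp
    then have "(z [^] k) [^] l \<otimes> (t \<otimes> y \<otimes> inv t) = (t \<otimes> y \<otimes> inv t) \<otimes> (z [^] k) [^] l"
      using t zG Pc[OF y] by (intro group_commutes_pow[of "z [^] k"]) auto
    then have "z \<otimes> (t \<otimes> y \<otimes> inv t) = (t \<otimes> y \<otimes> inv t) \<otimes> z" by (simp only: l[symmetric])
    then show "t \<otimes> y \<otimes> inv t \<in> C" using t Pc[OF y] by (simp add: C_def)
  qed
  have Qsub: "subgroup ?Q G"
  proof (rule subgroupI)
    show "?Q \<subseteq> carrier G" using t Pc by auto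
    show "?Q \<noteq> {}" using xP by blast
  next
    fix a assume "a \<in> ?Q"
    then obtain y where y: "y \<in> P" "a = t \<otimes> y \<otimes> inv t" by blast
    then have "inv a = t \<otimes> inv y \<otimes> inv t" using t Pc by (simp add: inv_mult_group m_assoc)
    then show "inv a \<in> ?Q" using subgroup.m_inv_closed[OF P y(1)] by blast
  next
    fix a b assume "a \<in> ?Q" "b \<in> ?Q"
    then obtain y w where y: "y \<in> P" "a = t \<otimes> y \<otimes> inv t" and w: "w \<in> P" "b = t \<otimes> w \<otimes> inv t"
      by blast
    then have "a \<otimes> b = t \<otimes> (y \<otimes> w) \<otimes> inv t" using t Pc by (simp add: m_assoc cancel_inv)
    then show "a \<otimes> b \<in> ?Q" using subgroup.m_closed[OF P y(1) w(1)] by blast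
  qed
  have cP: "card P = p ^ Suc a" using card_powers[OF P xP gen] o by simp
  have "inj_on (\<lambda>y. t \<otimes> y \<otimes> inv t) P"
    using t Pc by (intro inj_onI) simp
  then have cQ: "card ?Q = p ^ Suc a" using cP by (simp add: card_image)
  interpret C: group "G\<lparr>carrier := C\<rparr>" using subgroup_imp_group[OF C] .
  have finC: "finite C" using fin subgroup.subset[OF C] finite_subset by blast
  have "card (rcosets\<^bsub>G\<lparr>carrier := C\<rparr>\<^esub> P) * card P dvd card (rcosets P) * card P"
    using C.lagrange[of P] subgroup_incl[OF P C PC] lagrange[OF P] lagrange[OF C]
    by (simp add: order_def) (metis dvd_triv_right)
  moreover have "card P > 0" using subgroup.finite_imp_card_positive[OF P fin] .
  ultimately have "card (rcosets\<^bsub>G\<lparr>carrier := C\<rparr>\<^esub> P) dvd card (rcosets P)" by simp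
  then have "\<not> p dvd card (rcosets\<^bsub>G\<lparr>carrier := C\<rparr>\<^esub> P)" using ind dvd_trans by blast
  then have "\<exists>c\<in>C. \<forall>q\<in>?Q. c \<otimes> q \<otimes> inv\<^bsub>G\<lparr>carrier := C\<rparr>\<^esub> c \<in> P"
    using C.p_subgroup_conj_into[OF _ p _ _ _ cQ] finC
      subgroup_incl[OF P C PC] subgroup_incl[OF Qsub C QC] by simp
  then obtain c where c: "c \<in> C" and "\<forall>q\<in>?Q. c \<otimes> q \<otimes> inv c \<in> P"
    using m_inv_consistent[OF C] by auto
  then have cq: "c \<otimes> (t \<otimes> y \<otimes> inv t) \<otimes> inv c \<in> P" if "y \<in> P" for y using that by blast
  have cG: "c \<in> carrier G" using c by (simp add: C_def)
  define s where "s = c \<otimes> t"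
  have s: "s \<in> carrier G" unfolding s_def using cG t by simp
  have sP: "s \<otimes> y \<otimes> inv s \<in> P" if "y \<in> P" for y
    using cq[OF that] cG t Pc[OF that] by (simp add: s_def inv_mult_group m_assoc)
  have sz: "s \<otimes> z \<otimes> inv s = z [^] k"
  proof -
    have "s \<otimes> z \<otimes> inv s = c \<otimes> (t \<otimes> z \<otimes> inv t) \<otimes> inv c"
      using cG t zG by (simp add: s_def inv_mult_group m_assoc)
    also have "\<dots> = c \<otimes> z [^] k \<otimes> inv c" by (simp add: k)
    also have "\<dots> = (c \<otimes> z \<otimes> inv c) [^] k" using conj_nat_pow[OF cG zG] by simp
    also have "c \<otimes> z \<otimes> inv c = z" using conj_eq_iff_commute[OF cG zG zG] c by (simp add: C_def)
    finally show ?thesis .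
  qed
  obtain m :: nat where m: "s \<otimes> x \<otimes> inv s = x [^] m" using gen[OF sP[OF xP]] by blast
  have zm: "z [^] m = z [^] k"
  proof -
    have "s \<otimes> z \<otimes> inv s = (x [^] m) [^] (p ^ a)" using conj_nat_pow[OF s x] m z by simp
    also have "\<dots> = z [^] m" using x z by (simp add: nat_pow_pow mult.commute)
    finally show ?thesis using sz by simp
  qed
  have "m \<noteq> 0"
  proof
    assume "m = 0"
    then have "z [^] k = \<one>" using zm by simp
    then have "z = \<one>" using l by simp
    then show False using soc(1) by simp
  qed
  \<comment> \<open>Since \<open>m > 0\<close>, the truncated difference \<open>m - 1\<close> is the true one.\<close>
  have "\<not> p dvd m - 1"
  proof
    assume "p dvd m - 1"
    then have "[m = 1] (mod p)" using \<open>m \<noteq> 0\<close> by (metis One_nat_def Suc_leI cong_altdef_nat neq0_conv)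
    then have "z [^] m = z [^] (1::nat)" by (rule nat_pow_mod[OF zG soc(2)])
    then show False using zm k tz zG by simp
  qed
  then have "coprime (m - 1) (p ^ Suc a)"
    using p by (metis coprime_commute coprime_power_right_iff prime_imp_coprime)
  then obtain j where j: "[(m - 1) * j = 1] (mod p ^ Suc a)" using cong_solve_coprime_nat by (metis One_nat_def)
  have "x [^] m = x [^] (m - 1) \<otimes> x"
    using \<open>m \<noteq> 0\<close> x by (cases m) auto
  then have "x [^] (m - 1) = s \<otimes> x \<otimes> inv s \<otimes> inv x" using x s by (simp add: m m_assoc)
  then have "x [^] (m - 1) \<in> D" unfolding D_def using commutator_in_derived[OF s x] by simp
  then have "(x [^] (m - 1)) [^] j \<in> D" by (rule subgroup_nat_pow_closed[OF D])
  moreover have "(x [^] (m - 1)) [^] j = x"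
    using nat_pow_mod[OF x _ j] o x by (simp add: nat_pow_pow) (metis o pow_ord_eq_1 power_Suc)
  ultimately have "x \<in> D" by simp
  then show ?thesis unfolding D_def[symmetric] using gen subgroup_nat_pow_closed[OF D] by auto
qed

lemma (in group) nat_pow_eq_iff_cong:
  assumes "z \<in> carrier G" "ord z = n"
  shows "z [^] (i::nat) = z [^] (j::nat) \<longleftrightarrow> [i = j] (mod n)"
  using int_pow_eq[OF assms(1), of "int i" "int j"] assms(2)
  by (simp add: int_pow_int cong_iff_dvd_diff flip: cong_int_iff) (metis dvd_diff_commute)

text \<open>
  With \<open>m u = n v + 1\<close> both sides of \<open>k\<^sup>m\<^sup>u = (k\<^sup>n)\<^sup>v k\<close> are known modulo \<open>p\<close>.
\<close>

lemma cong_one_of_coprime_exponents: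
  fixes k m n p :: nat
  assumes "[k ^ m = 1] (mod p)" "[k ^ n = 1] (mod p)" "coprime m n" "m > 0"
  shows "[k = 1] (mod p)"
proof -
  obtain u v where uv: "m * u = n * v + 1"
    using bezout_nat[of m n] assms(3,4) by auto
  have "[(k ^ n) ^ v * k = 1 ^ v * k] (mod p)"
    using assms(2) by (intro cong_scalar_right cong_pow)
  then have "[k ^ (m * u) = k] (mod p)" by (simp add: uv power_mult mult.commute)
  moreover have "[k ^ (m * u) = 1 ^ u] (mod p)" unfolding power_mult using assms(1) by (rule cong_pow)
  ultimately show ?thesis by (metis cong_sym cong_trans power_one)
qed

lemma not_coprime_nat_prime:
  fixes m n :: nat
  assumes "\<not> coprime m n"
  obtains p where "Factorial_Ring.prime p" "p dvd m" "p dvd n"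
proof -
  have "gcd m n \<noteq> 1" using assms by (simp add: coprime_iff_gcd_eq_1)
  then obtain p where "Factorial_Ring.prime p" "p dvd gcd m n" using prime_factor_nat by blast
  then show thesis using that by simp
qed

text \<open>
  If some conjugate of the socle generator \<open>z\<close> lies in \<open>P\<close> and differs from \<open>z\<close>, then
  \<open>cyclic_sylow_le_derived\<close> applies; otherwise \<open>transfer_socle\<close> shows that \<open>z\<close> is outside
  the derived subgroup, which then meets \<open>P\<close> trivially. For the smallest prime divisor \<open>p\<close>
  only the second case is possible: from \<open>t z t\<^sup>-\<^sup>1 = z\<^sup>k\<close> one gets that \<open>k\<^sup>n\<close> is
  congruent to 1 modulo \<open>p\<close> for the group order \<open>n\<close>, and so is \<open>k\<^sup>p\<^sup>-\<^sup>1\<close> by Fermat, where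
  \<open>n\<close> and \<open>p - 1\<close> are coprime; so \<open>k\<close> itself is congruent to 1.
\<close>

lemma (in group) sylow_derived_dichotomy:
  fixes p :: nat
  assumes fin: "finite (carrier G)" and Z: "p_subgroups_cyclic G"
    and p: "Factorial_Ring.prime p" and dvd: "p dvd Coset.order G"
  obtains P where "subgroup P G" "card P = p ^ multiplicity p (Coset.order G)"
    "\<not> p dvd card (rcosets P)"
    "P \<subseteq> derived G (carrier G) \<or> P \<inter> derived G (carrier G) = {\<one>}"
    "(\<And>q. Factorial_Ring.prime q \<Longrightarrow> q dvd Coset.order G \<Longrightarrow> p \<le> q) \<Longrightarrow>
      P \<inter> derived G (carrier G) = {\<one>}"
proof -
  define D where "D = derived G (carrier G)"
  have D: "subgroup D G" unfolding D_def by (rule derived_is_subgroup) simp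
  obtain P where P: "subgroup P G" and cP: "card P = p ^ multiplicity p (Coset.order G)"
    and ind: "\<not> p dvd card (rcosets P)"
    using obtain_sylow[OF fin p] .
  obtain x where xP: "x \<in> P" and gen: "\<And>y. y \<in> P \<Longrightarrow> \<exists>i::nat. y = x [^] i"
    using Z p P cP unfolding p_subgroups_cyclic_def by metis
  have x: "x \<in> carrier G" using subgroup.mem_carrier[OF P xP] .
  have o0: "Coset.order G \<noteq> 0" using fin order_gt_0_iff_finite by simp
  have "multiplicity p (Coset.order G) > 0" using dvd p o0
    by (simp add: prime_multiplicity_gt_zero_iff)
  then obtain a where a: "multiplicity p (Coset.order G) = Suc a" using gr0_implies_Suc by blast
  then have o: "ord x = p ^ Suc a" using card_powers[OF P xP gen] cP by simp
  define z where "z = x [^] (p ^ a)"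
  note soc = cyclic_p_group_socle[OF x p o z_def]
  have zG: "z \<in> carrier G" using x z_def by simp
  have zP: "z \<in> P" unfolding z_def by (rule subgroup_nat_pow_closed[OF P xP])
  have triv: "P \<inter> D = {\<one>}" if "z \<notin> D"
  proof -
    have "y = \<one>" if y: "y \<in> P" "y \<in> D" for y
    proof (rule ccontr)
      assume "y \<noteq> \<one>"
      moreover obtain i :: nat where i: "y = x [^] i" using gen[OF y(1)] by blast
      ultimately obtain j :: nat where "z = y [^] j" using soc(4)[of i] by auto
      then show False using subgroup_nat_pow_closed[OF D y(2)] \<open>z \<notin> D\<close> by simp
    qed
    then show ?thesis using subgroup.one_closed[OF P] subgroup.one_closed[OF D] by blast
  qed
  have central: "z \<notin> D"
    if "\<And>t. t \<in> carrier G \<Longrightarrow> t \<otimes> z \<otimes> inv t \<in> P \<Longrightarrow> t \<otimes> z \<otimes> inv t = z"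
    unfolding D_def
    using transfer_socle[OF fin p P ind powers_comm_group[OF P xP gen] zP soc(1,2)] that by blast
  have "P \<subseteq> D \<or> P \<inter> D = {\<one>}"
    using cyclic_sylow_le_derived[OF fin p P ind xP gen o z_def] central triv
    unfolding D_def by blast
  moreover have "P \<inter> D = {\<one>}"
    if min: "\<And>q. Factorial_Ring.prime q \<Longrightarrow> q dvd Coset.order G \<Longrightarrow> p \<le> q"
  proof (rule triv, rule central)
    fix t assume t: "t \<in> carrier G" and tP: "t \<otimes> z \<otimes> inv t \<in> P"
    obtain k :: nat where k: "t \<otimes> z \<otimes> inv t = z [^] k"
      using socle_conj[OF p xP gen o z_def t tP P] by blast
    have it: "t [^] n \<otimes> z \<otimes> inv (t [^] n) = z [^] (k ^ n)" for n :: nat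
    proof (induction n)
      case 0
      then show ?case using zG by simp
    next
      case (Suc n)
      have "t [^] Suc n \<otimes> z \<otimes> inv (t [^] Suc n) = t [^] n \<otimes> (t \<otimes> z \<otimes> inv t) \<otimes> inv (t [^] n)"
        using t zG by (simp add: inv_mult_group m_assoc)
      also have "\<dots> = (t [^] n \<otimes> z \<otimes> inv (t [^] n)) [^] k"
        unfolding k using conj_nat_pow t zG by simp
      also have "\<dots> = z [^] (k ^ Suc n)"
        using Suc zG by (simp add: nat_pow_pow mult.commute)
      finally show ?case .
    qed
    have oz: "ord z = p"
    proof -
      have "ord z dvd p" using soc(2) zG pow_eq_id by simp
      moreover have "ord z \<noteq> 1" using soc(1) zG ord_eq_1 by blast
      ultimately show ?thesis using p by (metis prime_nat_iff)
    qed
    have "z [^] (k ^ Coset.order G) = z [^] (1::nat)"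
      using it[of "Coset.order G"] t zG by (simp add: pow_order_eq_1)
    then have 1: "[k ^ Coset.order G = 1] (mod p)"
      using nat_pow_eq_iff_cong[OF zG oz] by blast
    have "\<not> p dvd k"
    proof
      assume "p dvd k"
      then have "p dvd k ^ Coset.order G" using o0 by (simp add: dvd_power_same dvd_power gr0I dvd_trans)
      then have "p dvd 1" using 1 by (metis cong_dvd_iff)
      then show False using p by (metis not_prime_unit)
    qed
    then have 2: "[k ^ (p - 1) = 1] (mod p)" using fermat_theorem p by blast
    have "coprime (Coset.order G) (p - 1)"
    proof (rule ccontr)
      assume "\<not> coprime (Coset.order G) (p - 1)"
      then obtain q where q: "Factorial_Ring.prime q" "q dvd Coset.order G" "q dvd p - 1"
        using not_coprime_nat_prime by blast
      have "p > 1" using p prime_gt_1_nat by blast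
      then have "q \<le> p - 1" using q(3) by (intro dvd_imp_le) auto
      then show False using min[OF q(1,2)] \<open>p > 1\<close> by simp
    qed
    then have "[k = 1] (mod p)"
      using cong_one_of_coprime_exponents[OF 1 2] o0 by simp
    then have "z [^] k = z [^] (1::nat)" using nat_pow_eq_iff_cong[OF zG oz] by blast
    then show "t \<otimes> z \<otimes> inv t = z" using k zG by simp
  qed
  ultimately show thesis using that[OF P cP ind] unfolding D_def by blast
qed

text \<open>
  A Sylow subgroup for the smallest prime divisor of the order is nontrivial and meets the
  derived subgroup trivially.
\<close>

lemma (in group) derived_proper:
  assumes fin: "finite (carrier G)" and Z: "p_subgroups_cyclic G" and nt: "carrier G \<noteq> {\<one>}"
  shows "derived G (carrier G) \<noteq> carrier G"
proof
  assume eq: "derived G (carrier G) = carrier G"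
  have "Coset.order G \<noteq> 1" using nt order_one_triv_iff by simp
  then have ex: "\<exists>p. Factorial_Ring.prime p \<and> p dvd Coset.order G" using prime_factor_nat by blast
  define p where "p = (LEAST p. Factorial_Ring.prime p \<and> p dvd Coset.order G)"
  have p: "Factorial_Ring.prime p" "p dvd Coset.order G"
    using LeastI_ex[OF ex] unfolding p_def by auto
  have min: "p \<le> q" if "Factorial_Ring.prime q" "q dvd Coset.order G" for q
    unfolding p_def using that by (intro Least_le) auto
  obtain P where P: "subgroup P G" "card P = p ^ multiplicity p (Coset.order G)"
      "P \<inter> derived G (carrier G) = {\<one>}"
    using sylow_derived_dichotomy[OF fin Z p] min by metis
  then have "P = {\<one>}" using eq subgroup.subset[OF P(1)] by blast
  then have "p ^ multiplicity p (Coset.order G) = 1" using P(2) by simp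
  moreover have "Coset.order G \<noteq> 0" using fin order_gt_0_iff_finite by simp
  then have "multiplicity p (Coset.order G) > 0" using p by (simp add: prime_multiplicity_gt_zero_iff)
  ultimately show False using p(1) by (metis nat_power_eq_Suc_0_iff One_nat_def not_prime_1 less_numeral_extra(3))
qed

text \<open>
  A prime \<open>p\<close> dividing the order of the derived subgroup cannot have \<open>P \<inter> D\<close> trivial,
  since by Sylow \<open>P\<close> contains a conjugate of each \<open>p\<close>-subgroup of the normal subgroup \<open>D\<close>.
  So \<open>P \<le> D\<close>, and \<open>p\<close> does not divide the index.
\<close>

lemma (in group) derived_hall:
  assumes fin: "finite (carrier G)" and Z: "p_subgroups_cyclic G"
  shows "coprime (card (derived G (carrier G))) (card (rcosets (derived G (carrier G))))"
proof (rule ccontr)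
  define D where "D = derived G (carrier G)"
  assume "\<not> coprime (card (derived G (carrier G))) (card (rcosets (derived G (carrier G))))"
  then obtain p where p: "Factorial_Ring.prime p" "p dvd card D" "p dvd card (rcosets D)"
    unfolding D_def using not_coprime_nat_prime by blast
  have D: "subgroup D G" unfolding D_def by (rule derived_is_subgroup) simp
  interpret N: normal D G unfolding D_def by (rule derived_self_is_normal)
  have lag: "card (rcosets D) * card D = Coset.order G" by (rule lagrange[OF D])
  have finD: "finite D" using fin subgroup.subset[OF D] finite_subset by blast
  have pG: "p dvd Coset.order G" using p(2) by (simp flip: lag)
  obtain P where P: "subgroup P G" "card P = p ^ multiplicity p (Coset.order G)"
      "\<not> p dvd card (rcosets P)" "P \<subseteq> D \<or> P \<inter> D = {\<one>}"
    by (rule sylow_derived_dichotomy[OF fin Z p(1) pG, folded D_def]) (rule that; assumption)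
  from P(4) show False
  proof
    assume PD: "P \<subseteq> D"
    interpret D: group "G\<lparr>carrier := D\<rparr>" using subgroup_imp_group[OF D] .
    have "card P dvd card D"
      using D.lagrange[of P] subgroup_incl[OF P(1) D PD] by (simp add: order_def) (metis dvd_triv_right)
    then have "p * card P dvd card (rcosets D) * card D" using p(3) by (intro mult_dvd_mono)
    then have "p * card P dvd card (rcosets P) * card P" using lag lagrange[OF P(1)] by simp
    moreover have "card P > 0" using subgroup.finite_imp_card_positive[OF P(1) fin] .
    ultimately show False using P(3) by simp
  next
    assume PD: "P \<inter> D = {\<one>}"
    interpret D: group "G\<lparr>carrier := D\<rparr>" using subgroup_imp_group[OF D] .
    obtain Q where Q: "subgroup Q (G\<lparr>carrier := D\<rparr>)" "card Q = p ^ multiplicity p (card D)"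
      using D.obtain_sylow[OF _ p(1)] finD by (auto simp: order_def)
    have Q': "subgroup Q G" using incl_subgroup[OF D Q(1)] .
    have QD: "Q \<subseteq> D" using subgroup.subset[OF Q(1)] by simp
    obtain g where g: "g \<in> carrier G" "\<And>q. q \<in> Q \<Longrightarrow> g \<otimes> q \<otimes> inv g \<in> P"
      using p_subgroup_conj_into[OF fin p(1) P(1,3) Q' Q(2)] by blast
    have "q = \<one>" if q: "q \<in> Q" for q
    proof -
      have "g \<otimes> q \<otimes> inv g \<in> D" using N.inv_op_closed2[OF g(1)] q QD by blast
      then have "g \<otimes> q \<otimes> inv g = \<one>" using g(2)[OF q] PD by blast
      then have "g \<otimes> q = g"
        using conj_eq_iff_commute[OF g(1) _ one_closed] subgroup.mem_carrier[OF Q' q] g(1) by simp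
      then show ?thesis using g(1) subgroup.mem_carrier[OF Q' q] by simp
    qed
    then have "Q = {\<one>}" using subgroup.one_closed[OF Q'] by blast
    then have "p ^ multiplicity p (card D) = 1" using Q(2) by simp
    moreover have "card D > 0" using subgroup.finite_imp_card_positive[OF D fin] .
    then have "multiplicity p (card D) > 0" using p by (simp add: prime_multiplicity_gt_zero_iff)
    ultimately show False using p(1) by (metis nat_power_eq_Suc_0_iff One_nat_def not_prime_1 less_numeral_extra(3))
  qed
qed

section \<open>The derived subgroup is abelian\<close>

lemma (in comm_group) power_of_product_coprime:
  fixes M N :: nat
  assumes u: "u \<in> carrier G" and v: "v \<in> carrier G" and uM: "u [^] M = \<one>" and vN: "v [^] N = \<one>"
    and cop: "coprime M N"
  shows "\<exists>i::nat. v = (u \<otimes> v) [^] i"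
proof -
  have w: "(u \<otimes> v) [^] M = v [^] M" using u v uM by (simp add: nat_pow_distrib)
  obtain e where e: "[M * e = 1] (mod N)" using cong_solve_coprime_nat[OF cop] by auto
  have "(u \<otimes> v) [^] (M * e) = v [^] (M * e)" using u v w by (simp flip: nat_pow_pow)
  also have "\<dots> = v" using nat_pow_mod[OF v vN e] v by simp
  finally show ?thesis by metis
qed

text \<open>
  The image is generated by the images of the generators \<open>x p\<close> of Sylow subgroups. Since
  the image is abelian and these generators have coprime orders, the product of the
  generators alone already generates it. Working with the image, rather than with \<open>G\<close>,
  covers at the same time abelian groups (identity map) and quotients by a subgroup
  containing the commutators.
\<close>

lemma (in group) image_in_abelian_group_cyclic:
  assumes fin: "finite (carrier G)" and Z: "p_subgroups_cyclic G"
    and A: "comm_group A" and f: "f \<in> hom G A"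
  shows "\<exists>h\<in>carrier G. \<forall>y\<in>carrier G. \<exists>i::nat. f y = f (h [^] i)"
proof -
  interpret A: comm_group A by (rule A)
  interpret f: group_hom G A f using f by unfold_locales
  define n where "n p = p ^ multiplicity p (Coset.order G)" for p :: nat
  define x where "x p = (SOME x. x \<in> carrier G \<and> x [^] n p = \<one> \<and>
    (\<exists>P. subgroup P G \<and> card P = n p \<and> (\<forall>y\<in>P. \<exists>i::nat. y = x [^] i)))" for p
  have x: "x p \<in> carrier G \<and> x p [^] n p = \<one> \<and>
      (\<exists>P. subgroup P G \<and> card P = n p \<and> (\<forall>y\<in>P. \<exists>i::nat. y = x p [^] i))"
    if p: "Factorial_Ring.prime p" for p
    unfolding x_def
  proof (rule someI_ex)
    obtain P where P: "subgroup P G" "card P = n p"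
      using obtain_sylow[OF fin p] n_def by metis
    obtain y where y: "y \<in> P" and gen: "\<And>w. w \<in> P \<Longrightarrow> \<exists>i::nat. w = y [^] i"
      using Z p P unfolding p_subgroups_cyclic_def n_def by metis
    have yG: "y \<in> carrier G" using subgroup.mem_carrier[OF P(1) y] .
    have "y [^] n p = \<one>" using pow_ord_eq_1[OF yG] card_powers[OF P(1) y gen] P(2) by simp
    then show "\<exists>x. x \<in> carrier G \<and> x [^] n p = \<one> \<and>
      (\<exists>P. subgroup P G \<and> card P = n p \<and> (\<forall>y\<in>P. \<exists>i::nat. y = x [^] i))"
      using yG P gen by blast
  qed
  have main: "\<exists>h\<in>carrier G. f h [^]\<^bsub>A\<^esub> (\<Prod>p\<in>T. n p) = \<one>\<^bsub>A\<^esub> \<and> (\<forall>p\<in>T. \<exists>i::nat. f (x p) = f h [^]\<^bsub>A\<^esub> i)"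
    if "finite T" "\<forall>p\<in>T. Factorial_Ring.prime p" for T :: "nat set"
    using that
  proof (induction T rule: finite_induct)
    case empty
    then show ?case by (intro bexI[of _ \<one>]) auto
  next
    case (insert q T)
    then obtain h where h: "h \<in> carrier G" "f h [^]\<^bsub>A\<^esub> (\<Prod>p\<in>T. n p) = \<one>\<^bsub>A\<^esub>"
      and hT: "\<And>p. p \<in> T \<Longrightarrow> \<exists>i::nat. f (x p) = f h [^]\<^bsub>A\<^esub> i" by auto
    define N where "N = (\<Prod>p\<in>T. n p)"
    have q: "Factorial_Ring.prime q" using insert by simp
    have xq: "x q \<in> carrier G" "x q [^] n q = \<one>" using x[OF q] by auto
    have fxq: "f (x q) [^]\<^bsub>A\<^esub> n q = \<one>\<^bsub>A\<^esub>" using xq by (simp flip: f.hom_nat_pow)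
    have cop: "coprime N (n q)"
      unfolding N_def n_def
    proof (rule prod_coprime_left)
      fix p assume "p \<in> T"
      then have "Factorial_Ring.prime p" "p \<noteq> q" using insert by auto
      then show "coprime (p ^ multiplicity p (Coset.order G)) (q ^ multiplicity q (Coset.order G))"
        using q primes_coprime by auto
    qed
    define w where "w = h \<otimes> x q"
    have w: "w \<in> carrier G" "f w = f h \<otimes>\<^bsub>A\<^esub> f (x q)" unfolding w_def using h xq by auto
    obtain i :: nat where i: "f (x q) = f w [^]\<^bsub>A\<^esub> i"
      using A.power_of_product_coprime[of "f h" "f (x q)" N "n q"] h xq fxq cop w N_def by auto
    obtain j :: nat where j: "f h = f w [^]\<^bsub>A\<^esub> j"
      using A.power_of_product_coprime[of "f (x q)" "f h" "n q" N] h xq fxq cop w N_def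
      by (auto simp: coprime_commute A.m_comm)
    have "f w [^]\<^bsub>A\<^esub> (n q * N) = (f h [^]\<^bsub>A\<^esub> N) [^]\<^bsub>A\<^esub> n q \<otimes>\<^bsub>A\<^esub> (f (x q) [^]\<^bsub>A\<^esub> n q) [^]\<^bsub>A\<^esub> N"
      using h(1) xq(1) w by (simp add: A.nat_pow_distrib A.nat_pow_pow mult.commute)
    then have "f w [^]\<^bsub>A\<^esub> (\<Prod>p\<in>insert q T. n p) = \<one>\<^bsub>A\<^esub>"
      using h(2) fxq insert.hyps by (simp add: N_def)
    moreover have "\<exists>i::nat. f (x p) = f w [^]\<^bsub>A\<^esub> i" if pT: "p \<in> insert q T" for p
    proof (cases "p = q")
      case True
      then show ?thesis using i by blast
    next
      case False
      then obtain l :: nat where "f (x p) = f h [^]\<^bsub>A\<^esub> l" using hT pT by blast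
      then show ?thesis using j w(1) by (auto simp: A.nat_pow_pow)
    qed
    ultimately show ?case using w(1) by blast
  qed
  have o0: "Coset.order G \<noteq> 0" using fin order_gt_0_iff_finite by simp
  obtain h where h: "h \<in> carrier G"
    and hx: "\<And>p. p \<in> prime_factors (Coset.order G) \<Longrightarrow> \<exists>i::nat. f (x p) = f h [^]\<^bsub>A\<^esub> i"
    using main[of "prime_factors (Coset.order G)"] by (auto simp: in_prime_factors_iff)
  \<comment> \<open>The preimage of the subgroup generated by \<open>f h\<close> contains a Sylow subgroup for each prime, so its
  order is divisible by the order of \<open>G\<close>.\<close>
  define M where "M = {y \<in> carrier G. \<exists>i::nat. f y = f h [^]\<^bsub>A\<^esub> i}"
  have M: "subgroup M G"
  proof (rule subgroupI)
    have "f h = f h [^]\<^bsub>A\<^esub> (1::nat)" using h by simp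
    then show "M \<noteq> {}" using h unfolding M_def by blast
  next
    fix a assume "a \<in> M"
    then obtain i :: nat where a: "a \<in> carrier G" "f a = f h [^]\<^bsub>A\<^esub> i" by (auto simp: M_def)
    have "f a [^]\<^bsub>A\<^esub> (Coset.order G - 1) \<otimes>\<^bsub>A\<^esub> f a = f (a [^] Coset.order G)"
      using a(1) o0 by (metis A.nat_pow_Suc Suc_pred' f.hom_nat_pow neq0_conv)
    also have "\<dots> = \<one>\<^bsub>A\<^esub>" using a(1) by (simp add: pow_order_eq_1)
    finally have "inv\<^bsub>A\<^esub> (f a) = f a [^]\<^bsub>A\<^esub> (Coset.order G - 1)"
      using a(1) by (intro A.inv_equality) auto
    then have "f (inv a) = f h [^]\<^bsub>A\<^esub> (i * (Coset.order G - 1))"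
      using a h by (simp add: A.nat_pow_pow)
    then show "inv a \<in> M" using a(1) by (auto simp: M_def)
  next
    fix a b assume "a \<in> M" "b \<in> M"
    then obtain i j :: nat where ab: "a \<in> carrier G" "f a = f h [^]\<^bsub>A\<^esub> i" "b \<in> carrier G" "f b = f h [^]\<^bsub>A\<^esub> j"
      by (auto simp: M_def)
    then have "f (a \<otimes> b) = f h [^]\<^bsub>A\<^esub> (i + j)" using h by (simp add: A.nat_pow_mult)
    then show "a \<otimes> b \<in> M" using ab by (auto simp: M_def)
  qed (auto simp: M_def)
  have "Coset.order G dvd card M"
  proof (rule multiplicity_le_imp_dvd[OF o0])
    fix p :: nat assume p: "Factorial_Ring.prime p"
    have M0: "card M > 0" using subgroup.finite_imp_card_positive[OF M fin] .
    show "multiplicity p (Coset.order G) \<le> multiplicity p (card M)"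
    proof (cases "p dvd Coset.order G")
      case False
      then show ?thesis by (simp add: not_dvd_imp_multiplicity_0)
    next
      case True
      then have "p \<in> prime_factors (Coset.order G)" using p o0 by (simp add: in_prime_factors_iff)
      then obtain l :: nat where l: "f (x p) = f h [^]\<^bsub>A\<^esub> l" using hx by blast
      obtain P where P: "subgroup P G" "card P = n p" and gen: "\<And>y. y \<in> P \<Longrightarrow> \<exists>i::nat. y = x p [^] i"
        and xp: "x p \<in> carrier G" using x[OF p] by blast
      have PM: "P \<subseteq> M"
      proof
        fix y assume y: "y \<in> P"
        then obtain i :: nat where "y = x p [^] i" using gen by blast
        then have "f y = f h [^]\<^bsub>A\<^esub> (l * i)" using xp h l by (simp add: f.hom_nat_pow A.nat_pow_pow)
        then show "y \<in> M" using subgroup.mem_carrier[OF P(1) y] by (auto simp: M_def)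
      qed
      interpret M: group "G\<lparr>carrier := M\<rparr>" using subgroup_imp_group[OF M] .
      have "n p dvd card M"
        using M.lagrange[of P] subgroup_incl[OF P(1) M PM] P(2) by (simp add: order_def) (metis dvd_triv_right)
      then show ?thesis
        using p M0 unfolding n_def by (intro multiplicity_geI) (auto simp: not_prime_unit)
    qed
  qed
  then have "card (carrier G) \<le> card M"
    using subgroup.finite_imp_card_positive[OF M fin] by (intro dvd_imp_le) (auto simp: order_def)
  then have "M = carrier G"
    using card_seteq[OF fin] subgroup.subset[OF M] by blast
  then have "\<forall>y\<in>carrier G. \<exists>i::nat. f y = f (h [^] i)" using h by (auto simp: M_def f.hom_nat_pow)
  then show ?thesis using h by blast
qed

lemma (in group) abelian_subgroup_cyclic:
  assumes fin: "finite (carrier G)" and Z: "p_subgroups_cyclic G" and A: "subgroup A G"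
    and comm: "\<And>a b. a \<in> A \<Longrightarrow> b \<in> A \<Longrightarrow> a \<otimes> b = b \<otimes> a"
  shows "\<exists>x\<in>A. \<forall>y\<in>A. \<exists>i::nat. y = x [^] i"
proof -
  interpret A: group "G\<lparr>carrier := A\<rparr>" using subgroup_imp_group[OF A] .
  have "comm_group (G\<lparr>carrier := A\<rparr>)" using comm by (intro A.group_comm_groupI) simp
  moreover have "finite A" using fin subgroup.subset[OF A] finite_subset by blast
  ultimately have "\<exists>h\<in>A. \<forall>y\<in>A. \<exists>i::nat. y = h [^]\<^bsub>G\<lparr>carrier := A\<rparr>\<^esub> i"
    using A.image_in_abelian_group_cyclic[OF _ p_subgroups_cyclic_subgroup[OF Z A], of "G\<lparr>carrier := A\<rparr>" "\<lambda>x. x"]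
    by (simp add: hom_def)
  then show ?thesis by (simp flip: nat_pow_consistent)
qed

text \<open>
  The automorphisms of a cyclic group commute, hence commutators act trivially on a cyclic
  normal subgroup.
\<close>

lemma (in group) derived_centralizes_normal_cyclic:
  assumes N: "N \<lhd> G" and a: "a \<in> N" and gen: "\<And>y. y \<in> N \<Longrightarrow> \<exists>i::nat. y = a [^] i"
    and d: "d \<in> derived G (carrier G)"
  shows "d \<otimes> a = a \<otimes> d"
proof -
  interpret N: normal N G by (rule N)
  have aG: "a \<in> carrier G" using a by (rule N.mem_carrier)
  define C where "C = {t \<in> carrier G. t \<otimes> a = a \<otimes> t}"
  have C: "subgroup C G" unfolding C_def by (rule centralizer_subgroup[OF aG])
  have conj: "(g \<otimes> h) \<otimes> y \<otimes> inv (g \<otimes> h) = (h \<otimes> g) \<otimes> y \<otimes> inv (h \<otimes> g)"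
    if g: "g \<in> carrier G" and h: "h \<in> carrier G" and y: "y \<in> N" for g h y
  proof -
    obtain k :: nat where k: "g \<otimes> a \<otimes> inv g = a [^] k" using gen[OF N.inv_op_closed2[OF g a]] by blast
    obtain l :: nat where l: "h \<otimes> a \<otimes> inv h = a [^] l" using gen[OF N.inv_op_closed2[OF h a]] by blast
    obtain i :: nat where i: "y = a [^] i" using gen[OF y] by blast
    have gi: "g \<otimes> a [^] j \<otimes> inv g = a [^] (k * j)" for j :: nat
      using conj_nat_pow[OF g aG, of j] k aG by (simp add: nat_pow_pow)
    have hi: "h \<otimes> a [^] j \<otimes> inv h = a [^] (l * j)" for j :: nat
      using conj_nat_pow[OF h aG, of j] l aG by (simp add: nat_pow_pow)
    have "(g \<otimes> h) \<otimes> y \<otimes> inv (g \<otimes> h) = g \<otimes> (h \<otimes> a [^] i \<otimes> inv h) \<otimes> inv g"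
      using g h aG i by (simp add: inv_mult_group m_assoc)
    also have "\<dots> = h \<otimes> (g \<otimes> a [^] i \<otimes> inv g) \<otimes> inv h"
      unfolding gi hi by (simp add: mult.left_commute)
    also have "\<dots> = (h \<otimes> g) \<otimes> y \<otimes> inv (h \<otimes> g)"
      using g h aG i by (simp add: inv_mult_group m_assoc)
    finally show ?thesis .
  qed
  have "derived_set G (carrier G) \<subseteq> C"
  proof clarify
    fix g h assume g: "g \<in> carrier G" and h: "h \<in> carrier G"
    define y where "y = inv (h \<otimes> g) \<otimes> a \<otimes> (h \<otimes> g)"
    have yN: "y \<in> N" unfolding y_def using N.inv_op_closed1[of "h \<otimes> g" a] g h a by simp
    have c: "g \<otimes> h \<otimes> inv g \<otimes> inv h = (g \<otimes> h) \<otimes> inv (h \<otimes> g)"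
      using g h by (simp add: inv_mult_group m_assoc)
    have "(h \<otimes> g) \<otimes> y \<otimes> inv (h \<otimes> g) = a"
      unfolding y_def using g h aG by (simp add: m_assoc cancel_inv)
    then have "(g \<otimes> h) \<otimes> y \<otimes> inv (g \<otimes> h) = a" using conj[OF g h yN] by simp
    then have "(g \<otimes> h) \<otimes> y = a \<otimes> (g \<otimes> h)"
      using conj_eq_iff_commute[of "g \<otimes> h" y a] g h aG N.mem_carrier[OF yN] by simp
    moreover have "(g \<otimes> h) \<otimes> y = (g \<otimes> h) \<otimes> inv (h \<otimes> g) \<otimes> a \<otimes> (h \<otimes> g)"
      unfolding y_def using g h aG by (simp add: m_assoc)
    ultimately have "(g \<otimes> h) \<otimes> inv (h \<otimes> g) \<otimes> a = a \<otimes> (g \<otimes> h) \<otimes> inv (h \<otimes> g)"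
      using g h aG by (simp add: inv_solve_right)
    then show "g \<otimes> h \<otimes> inv g \<otimes> inv h \<in> C" unfolding c C_def using g h aG by (simp add: m_assoc)
  qed
  then have "derived G (carrier G) \<subseteq> C"
    unfolding derived_def using generate_subgroup_incl C by blast
  then show ?thesis using d by (auto simp: C_def)
qed

text \<open>
  Let \<open>D\<close> be the derived subgroup and \<open>E\<close> the second one. By \<open>IH\<close> and the cyclic Sylow
  subgroups, \<open>E\<close> is cyclic; it is normal in \<open>G\<close>, so \<open>D\<close> centralizes it. The quotient \<open>D/E\<close>
  is abelian and therefore cyclic. A group with a cyclic quotient by a central subgroup is
  abelian.
\<close>

lemma (in group) derived_abelian_step:
  assumes fin: "finite (carrier G)" and Z: "p_subgroups_cyclic G"
    and IH: "\<And>a b. a \<in> derived G (derived G (carrier G)) \<Longrightarrow>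
      b \<in> derived G (derived G (carrier G)) \<Longrightarrow> a \<otimes> b = b \<otimes> a"
    and "y \<in> derived G (carrier G)" "w \<in> derived G (carrier G)"
  shows "y \<otimes> w = w \<otimes> y"
proof -
  define D where "D = derived G (carrier G)"
  define E where "E = derived G D"
  have D: "subgroup D G" unfolding D_def by (rule derived_is_subgroup) simp
  interpret D: group "G\<lparr>carrier := D\<rparr>" using subgroup_imp_group[OF D] .
  have DG: "D \<subseteq> carrier G" by (rule subgroup.subset[OF D])
  have finD: "finite D" using fin DG finite_subset by blast
  have ZD: "p_subgroups_cyclic (G\<lparr>carrier := D\<rparr>)" by (rule p_subgroups_cyclic_subgroup[OF Z D])
  have EN: "E \<lhd> G" unfolding E_def D_def by (intro derived_is_normal derived_self_is_normal)
  have E: "subgroup E G" using EN normal_imp_subgroup by blast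
  have ED: "derived (G\<lparr>carrier := D\<rparr>) D = E" unfolding E_def by (rule derived_consistent[OF _ D]) simp
  have yw: "y \<in> D" "w \<in> D" using assms by (auto simp: D_def)
  have Ecomm: "a \<otimes> b = b \<otimes> a" if "a \<in> E" "b \<in> E" for a b
    using IH that unfolding E_def D_def .
  obtain a where a: "a \<in> E" "\<And>y. y \<in> E \<Longrightarrow> \<exists>i::nat. y = a [^] i"
    using abelian_subgroup_cyclic[OF fin Z E Ecomm] by blast
  have aG: "a \<in> carrier G" using subgroup.mem_carrier[OF E a(1)] .
  have central: "d \<otimes> e = e \<otimes> d" if d: "d \<in> D" and e: "e \<in> E" for d e
  proof -
    obtain i :: nat where i: "e = a [^] i" using a(2)[OF e] by blast
    have "a \<otimes> d = d \<otimes> a"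
      using derived_centralizes_normal_cyclic[OF EN a] d unfolding D_def by metis
    then have "a [^] i \<otimes> d = d \<otimes> a [^] i" using aG d DG by (intro group_commutes_pow) auto
    then show ?thesis using i by simp
  qed
  have EN': "E \<lhd> G\<lparr>carrier := D\<rparr>" using D.derived_self_is_normal ED by simp
  have "\<exists>h\<in>D. \<forall>y\<in>D. \<exists>i::nat. E #> y = E #> (h [^] i)"
    using D.image_in_abelian_group_cyclic[OF _ ZD D.derived_quot_is_comm_group
        normal.r_coset_hom_Mod[OF D.derived_self_is_normal]] finD
    by (simp add: ED flip: nat_pow_consistent)
  then obtain h where h: "h \<in> D" and hgen: "\<And>y. y \<in> D \<Longrightarrow> \<exists>i::nat. E #> y = E #> (h [^] i)" by blast
  have hG: "h \<in> carrier G" using h DG by blast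
  have form: "\<exists>e\<in>E. \<exists>i::nat. y = e \<otimes> h [^] i" if y: "y \<in> D" for y
  proof -
    obtain i :: nat where i: "E #> y = E #> (h [^] i)" using hgen[OF y] by blast
    have yG: "y \<in> carrier G" using y DG by blast
    have "y \<otimes> inv (h [^] i) \<in> E" using rcoset_eq_iff[OF E yG, of "h [^] i"] i hG by simp
    moreover have "y = y \<otimes> inv (h [^] i) \<otimes> h [^] i" using yG hG by (simp add: m_assoc)
    ultimately show ?thesis by blast
  qed
  obtain e i where y: "e \<in> E" "y = e \<otimes> h [^] (i::nat)" using form[OF yw(1)] by blast
  obtain e' j where w: "e' \<in> E" "w = e' \<otimes> h [^] (j::nat)" using form[OF yw(2)] by blast
  have eG: "e \<in> carrier G" "e' \<in> carrier G" using y w subgroup.mem_carrier[OF E] by auto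
  have hD: "h [^] n \<in> D" for n :: nat by (rule subgroup_nat_pow_closed[OF D h])
  have hh: "h [^] i \<otimes> h [^] j = h [^] j \<otimes> h [^] i" using hG by (simp add: nat_pow_mult add.commute)
  have "y \<otimes> w = e \<otimes> (h [^] i \<otimes> e') \<otimes> h [^] j" unfolding y w using eG hG by (simp add: m_assoc)
  also have "\<dots> = e \<otimes> e' \<otimes> (h [^] i \<otimes> h [^] j)" unfolding central[OF hD w(1)] using eG hG by (simp add: m_assoc)
  also have "\<dots> = e' \<otimes> e \<otimes> (h [^] j \<otimes> h [^] i)" using Ecomm[OF y(1) w(1)] hh by simp
  also have "\<dots> = e' \<otimes> (e \<otimes> h [^] j) \<otimes> h [^] i" using eG hG by (simp add: m_assoc)
  also have "\<dots> = w \<otimes> y" unfolding y w central[OF hD[of j] y(1), symmetric] using eG hG by (simp add: m_assoc)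
  finally show ?thesis .
qed

text \<open>
  Induction on the order of the group; the hypothesis is applied to the derived subgroup,
  which \<open>derived_proper\<close> shows to be smaller unless \<open>G\<close> is trivial.
\<close>

lemma derived_abelian:
  assumes "group G" "finite (carrier G)" "p_subgroups_cyclic G"
    and "y \<in> derived G (carrier G)" "w \<in> derived G (carrier G)"
  shows "y \<otimes>\<^bsub>G\<^esub> w = w \<otimes>\<^bsub>G\<^esub> y"
  using assms
proof (induction "card (carrier G)" arbitrary: G y w rule: less_induct)
  case less
  interpret group G by fact
  note fin = less.prems(2) and Z = less.prems(3)
  define D where "D = derived G (carrier G)"
  have D: "subgroup D G" unfolding D_def by (rule derived_is_subgroup) simp
  show ?case
  proof (cases "carrier G = {\<one>\<^bsub>G\<^esub>}")
    case True
    then have "y = \<one>\<^bsub>G\<^esub>" "w = \<one>\<^bsub>G\<^esub>"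
      using less.prems(4,5) subgroup.subset[OF D] by (auto simp: D_def)
    then show ?thesis by simp
  next
    case False
    then have "D \<noteq> carrier G" unfolding D_def by (rule derived_proper[OF fin Z])
    then have "card D < card (carrier G)"
      using subgroup.subset[OF D] fin by (intro psubset_card_mono) auto
    moreover have "finite D" using fin subgroup.subset[OF D] finite_subset by blast
    moreover have "derived (G\<lparr>carrier := D\<rparr>) D = derived G D" by (rule derived_consistent[OF _ D]) simp
    ultimately have "a \<otimes>\<^bsub>G\<^esub> b = b \<otimes>\<^bsub>G\<^esub> a" if "a \<in> derived G D" "b \<in> derived G D" for a b
      using less.hyps[of "G\<lparr>carrier := D\<rparr>" a b] that subgroup_imp_group[OF D]
        p_subgroups_cyclic_subgroup[OF Z D] by simp
    then show ?thesis
      using derived_abelian_step[OF fin Z _ less.prems(4,5)] unfolding D_def by blast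
  qed
qed

section \<open>Pointwise conjugate homomorphisms\<close>

text \<open>
  The vanishing of the first cohomology of a cyclic group of order prime to that of the
  abelian group \<open>A\<close>, in elementary form. Writing \<open>(d a)\<^sup>i = d\<^sup>i f\<^sub>i\<close> and \<open>\<delta> y = d\<^sup>-\<^sup>1 y
  d\<close>, one has \<open>f\<^sub>i\<^sub>+\<^sub>1 = \<delta> f\<^sub>i \<otimes> a\<close>. The product \<open>F\<close> of \<open>f\<^sub>0, \<dots>, f\<^sub>s\<^sub>-\<^sub>1\<close> then satisfies
  \<open>F = \<delta> F \<otimes> a\<^sup>s\<close>, because \<open>f\<^sub>s = f\<^sub>0 = \<one>\<close>, and a power of \<open>F\<close> with exponent inverse to
  \<open>s\<close> modulo the order of \<open>A\<close> is the required \<open>c\<close>.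
\<close>

lemma (in group) coprime_complement_conj:
  assumes A: "subgroup A G" and comm: "comm_group (G\<lparr>carrier := A\<rparr>)" and finA: "finite A"
    and d: "d \<in> carrier G" and norm: "\<And>y. y \<in> A \<Longrightarrow> inv d \<otimes> y \<otimes> d \<in> A"
    and a: "a \<in> A" and ds: "d [^] (s::nat) = \<one>" and das: "(d \<otimes> a) [^] s = \<one>"
    and cop: "coprime s (card A)"
  shows "\<exists>c\<in>A. inv c \<otimes> d \<otimes> c = d \<otimes> a"
proof -
  interpret A: comm_group "G\<lparr>carrier := A\<rparr>" by (rule comm)
  have AG: "y \<in> carrier G" if "y \<in> A" for y using subgroup.mem_carrier[OF A that] .
  have aG: "a \<in> carrier G" using AG a .
  have mc: "y \<otimes> w = w \<otimes> y" if "y \<in> A" "w \<in> A" for y w using A.m_comm[of y w] that by simp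
  have cl: "y \<otimes> w \<in> A" if "y \<in> A" "w \<in> A" for y w using subgroup.m_closed[OF A that] .
  define \<delta> where "\<delta> y = inv d \<otimes> y \<otimes> d" for y
  have \<delta>A: "\<delta> y \<in> A" if "y \<in> A" for y unfolding \<delta>_def using norm[OF that] .
  have \<delta>_mult: "\<delta> (y \<otimes> w) = \<delta> y \<otimes> \<delta> w" if "y \<in> A" "w \<in> A" for y w
    unfolding \<delta>_def using AG that d by (simp add: m_assoc cancel_inv)
  have d\<delta>: "y \<otimes> d = d \<otimes> \<delta> y" if "y \<in> A" for y
    unfolding \<delta>_def using AG that d by (simp add: m_assoc cancel_inv)
  define f where "f i = inv (d [^] i) \<otimes> (d \<otimes> a) [^] i" for i :: nat
  have df: "(d \<otimes> a) [^] i = d [^] i \<otimes> f i" for i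
    unfolding f_def using d aG by (simp add: cancel_inv)
  have f0: "f 0 = \<one>" unfolding f_def by simp
  have fs: "f s = \<one>" unfolding f_def using ds das by simp
  have fA: "f i \<in> A" and fS: "f (Suc i) = \<delta> (f i) \<otimes> a" for i
  proof -
    have step: "f (Suc i) = \<delta> (f i) \<otimes> a" if "f i \<in> A" for i
    proof -
      have "d [^] Suc i \<otimes> f (Suc i) = (d [^] i \<otimes> f i) \<otimes> (d \<otimes> a)"
        unfolding df[symmetric] by simp
      also have "\<dots> = d [^] i \<otimes> (f i \<otimes> d) \<otimes> a" using d aG AG[OF that] by (simp add: m_assoc)
      also have "\<dots> = d [^] Suc i \<otimes> (\<delta> (f i) \<otimes> a)"
        unfolding d\<delta>[OF that] using d aG AG[OF \<delta>A[OF that]] by (simp add: m_assoc)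
      finally show ?thesis using d aG AG[OF \<delta>A[OF that]] by (simp add: f_def)
    qed
    show *: "f i \<in> A" for i
    proof (induction i)
      case 0
      then show ?case using f0 subgroup.one_closed[OF A] by simp
    next
      case (Suc i)
      then show ?case using step cl[OF \<delta>A a] by simp
    qed
    show "f (Suc i) = \<delta> (f i) \<otimes> a" by (rule step[OF *])
  qed
  \<comment> \<open>The product of \<open>f 0, \<dots>, f (n - 1)\<close>.\<close>
  define F where "F n = rec_nat \<one> (\<lambda>i w. w \<otimes> f i) n" for n :: nat
  have F0: "F 0 = \<one>" and FS: "F (Suc n) = F n \<otimes> f n" for n by (simp_all add: F_def)
  have FA: "F n \<in> A" for n
    by (induction n) (use F0 FS fA cl subgroup.one_closed[OF A] in auto)
  have shift: "F n \<otimes> f n = \<delta> (F n) \<otimes> a [^] n" for n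
  proof (induction n)
    case 0
    then show ?case using F0 f0 d by (simp add: \<delta>_def)
  next
    case (Suc n)
    have "F (Suc n) \<otimes> f (Suc n) = (\<delta> (F n) \<otimes> a [^] n) \<otimes> (\<delta> (f n) \<otimes> a)"
      unfolding FS fS Suc ..
    also have "\<dots> = \<delta> (F n) \<otimes> (a [^] n \<otimes> \<delta> (f n)) \<otimes> a"
      using AG[OF \<delta>A[OF FA]] AG[OF \<delta>A[OF fA]] aG by (simp add: m_assoc)
    also have "\<dots> = \<delta> (F (Suc n)) \<otimes> a [^] Suc n"
      unfolding mc[OF subgroup_nat_pow_closed[OF A a] \<delta>A[OF fA]] FS \<delta>_mult[OF FA fA]
      using AG[OF \<delta>A[OF FA]] AG[OF \<delta>A[OF fA]] aG by (simp add: m_assoc)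
    finally show ?case .
  qed
  have Fs: "F s = \<delta> (F s) \<otimes> a [^] s" using shift[of s] fs AG[OF FA] by simp
  obtain r where r: "[s * r = 1] (mod card A)" using cong_solve_coprime_nat[OF cop] by auto
  define c where "c = F s [^] r"
  have cA: "c \<in> A" unfolding c_def by (rule subgroup_nat_pow_closed[OF A FA])
  have acard: "a [^] card A = \<one>"
    using A.pow_order_eq_1[of a] a by (simp add: order_def flip: nat_pow_consistent)
  have "c = (\<delta> (F s) \<otimes> a [^] s) [^] r" unfolding c_def using Fs by simp
  also have "\<dots> = \<delta> (F s) [^] r \<otimes> (a [^] s) [^] r"
    using mc[OF \<delta>A[OF FA] subgroup_nat_pow_closed[OF A a]] AG[OF \<delta>A[OF FA]] aG
    by (intro pow_mult_distrib) auto
  also have "(a [^] s) [^] r = a" using nat_pow_mod[OF aG acard r] aG by (simp add: nat_pow_pow)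
  also have "\<delta> (F s) [^] r = \<delta> c"
    unfolding \<delta>_def c_def using conj_nat_pow[of "inv d" "F s" r] d AG[OF FA] by simp
  finally have c: "c = \<delta> c \<otimes> a" .
  have "d \<otimes> c = d \<otimes> \<delta> c \<otimes> a" using c d AG[OF \<delta>A[OF cA]] aG by (metis m_assoc)
  also have "\<dots> = c \<otimes> d \<otimes> a" using d\<delta>[OF cA] by simp
  finally have "inv c \<otimes> d \<otimes> c = d \<otimes> a"
    using d aG AG[OF cA] by (simp add: m_assoc cancel_inv)
  then show ?thesis using cA by blast
qed

text \<open>
  Only the two generators \<open>b\<close> and \<open>d\<close> of \<open>H\<close> have to be treated. A conjugating element \<open>g\<close>
  for \<open>b\<close> may be changed by the abelian group \<open>A\<close>, which contains \<open>b\<close>, and by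
  \<open>coprime_complement_conj\<close> this freedom is enough to make it correct for \<open>d\<close> as well.
\<close>

theorem (in group) pointwise_conj_hom_is_conj:
  assumes fin: "finite (carrier G)" and Z: "p_subgroups_cyclic G" and H: "subgroup H G"
    and \<phi>: "\<phi> \<in> hom (G\<lparr>carrier := H\<rparr>) G"
    and pw: "\<And>h. h \<in> H \<Longrightarrow> \<exists>g\<in>carrier G. \<phi> h = g \<otimes> h \<otimes> inv g"
  shows "\<exists>g\<in>carrier G. \<forall>h\<in>H. \<phi> h = g \<otimes> h \<otimes> inv g"
proof -
  define A where "A = derived G (carrier G)"
  define s where "s = card (rcosets A)"
  have A: "subgroup A G" unfolding A_def by (rule derived_is_subgroup) simp
  interpret N: normal A G unfolding A_def by (rule derived_self_is_normal)
  interpret A: group "G\<lparr>carrier := A\<rparr>" using subgroup_imp_group[OF A] .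
  interpret H: group "G\<lparr>carrier := H\<rparr>" using subgroup_imp_group[OF H] .
  interpret Q: group "G Mod A" by (rule N.factorgroup_is_group)
  interpret \<phi>: group_hom "G\<lparr>carrier := H\<rparr>" G \<phi> using \<phi> by unfold_locales
  have finA: "finite A" using fin N.subset finite_subset by blast
  have finH: "finite H" using fin subgroup.subset[OF H] finite_subset by blast
  have HG: "h \<in> carrier G" if "h \<in> H" for h using subgroup.mem_carrier[OF H that] .
  have Acomm: "y \<otimes> w = w \<otimes> y" if "y \<in> A" "w \<in> A" for y w
    using derived_abelian[OF is_group fin Z] that unfolding A_def by blast
  have AC: "comm_group (G\<lparr>carrier := A\<rparr>)" using Acomm by (intro A.group_comm_groupI) simp
  have cop: "coprime s (card A)"
    using derived_hall[OF fin Z] unfolding s_def A_def by (simp add: coprime_commute)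
  have lag: "s * card A = Coset.order G" unfolding s_def by (rule lagrange[OF A])
  have powA: "g [^] s \<in> A" if g: "g \<in> carrier G" for g
  proof -
    have "A #> (g [^] s) = (A #> g) [^]\<^bsub>G Mod A\<^esub> s"
      using N.FactGroup_pow[OF g, of s] by simp
    also have "\<dots> = \<one>\<^bsub>G Mod A\<^esub>"
      using Q.pow_order_eq_1[of "A #> g"] g
      by (simp add: carrier_FactGroup order_def s_def FactGroup_def RCOSETS_def UNION_singleton_eq_range)
    finally have "A #> (g [^] s) = A" by simp
    then show ?thesis using g rcos_self[OF _ A, of "g [^] s"] by simp
  qed
  define B where "B = H \<inter> A"
  have B: "subgroup B G" unfolding B_def by (rule subgroups_Inter_pair[OF H A])
  obtain b where b: "b \<in> B" and bgen: "\<And>y. y \<in> B \<Longrightarrow> \<exists>i::nat. y = b [^] i"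
    using abelian_subgroup_cyclic[OF fin Z B] Acomm B_def by blast
  have bH: "b \<in> H" and bA: "b \<in> A" using b by (auto simp: B_def)
  have bG: "b \<in> carrier G" using HG[OF bH] .
  have f: "(\<lambda>y. A #> y) \<in> hom (G\<lparr>carrier := H\<rparr>) (G Mod A)"
    using N.r_coset_hom_Mod HG by (auto simp: hom_def)
  have "comm_group (G Mod A)" unfolding A_def by (rule derived_quot_is_comm_group)
  then have "\<exists>h\<in>H. \<forall>y\<in>H. \<exists>i::nat. A #> y = A #> (h [^] i)"
    using H.image_in_abelian_group_cyclic[OF _ p_subgroups_cyclic_subgroup[OF Z H] _ f] finH
    by (simp flip: nat_pow_consistent)
  then obtain k where k: "k \<in> H" and kgen: "\<And>y. y \<in> H \<Longrightarrow> \<exists>i::nat. A #> y = A #> (k [^] i)"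
    by blast
  have kG: "k \<in> carrier G" using HG[OF k] .
  have kH: "k [^] n \<in> H" for n :: nat by (rule subgroup_nat_pow_closed[OF H k])
  \<comment> \<open>This power of \<open>k\<close> has order dividing the index \<open>s\<close>, and as \<open>card A\<close> is invertible modulo
  \<open>s\<close> it generates the same subgroup of the quotient by \<open>A\<close> as \<open>k\<close>.\<close>
  define d where "d = k [^] card A"
  have dH: "d \<in> H" unfolding d_def by (rule kH)
  have dG: "d \<in> carrier G" using HG[OF dH] .
  have ds: "d [^] s = \<one>"
    unfolding d_def using kG lag pow_order_eq_1[OF kG] by (simp add: nat_pow_pow mult.commute)
  have form: "\<exists>(i::nat) (j::nat). h = b [^] i \<otimes> d [^] j" if h: "h \<in> H" for h
  proof -
    obtain i :: nat where i: "A #> h = A #> (k [^] i)" using kgen[OF h] by blast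
    obtain r where r: "[card A * r = 1] (mod s)"
      using cong_solve_coprime_nat[of "card A" s] cop by (auto simp: coprime_commute)
    have ri: "[card A * r * i = 1 * i] (mod s)" using r by (rule cong_scalar_right)
    have kk: "k [^] i \<otimes> inv (d [^] (r * i)) \<in> A"
    proof -
      let ?q = "A #> k"
      have q: "?q \<in> carrier (G Mod A)" using kG by (simp add: carrier_FactGroup)
      have "A #> (k [^] s) = A" using powA[OF kG] kG by (intro coset_join2[OF _ A]) auto
      then have "?q [^]\<^bsub>G Mod A\<^esub> s = \<one>\<^bsub>G Mod A\<^esub>" using N.FactGroup_pow[OF kG, of s] by simp
      then have "?q [^]\<^bsub>G Mod A\<^esub> (card A * r * i) = ?q [^]\<^bsub>G Mod A\<^esub> (1 * i)"
        by (rule Q.nat_pow_mod[OF q _ ri])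
      then have "A #> (k [^] i) = A #> (d [^] (r * i))"
        using N.FactGroup_pow[OF kG] kG unfolding d_def by (simp add: nat_pow_pow mult.assoc)
      then show ?thesis using rcoset_eq_iff[OF A, of "k [^] i" "d [^] (r * i)"] kG dG by simp
    qed
    have hG: "h \<in> carrier G" using HG[OF h] .
    have "A #> h = A #> (d [^] (r * i))"
      using i kk rcoset_eq_iff[OF A, of "k [^] i" "d [^] (r * i)"] kG dG by simp
    then have "h \<otimes> inv (d [^] (r * i)) \<in> A"
      using rcoset_eq_iff[OF A hG, of "d [^] (r * i)"] dG by simp
    moreover have "h \<otimes> inv (d [^] (r * i)) \<in> H"
      using h subgroup.m_inv_closed[OF H subgroup_nat_pow_closed[OF H dH]] subgroup.m_closed[OF H] by blast
    ultimately obtain j :: nat where "h \<otimes> inv (d [^] (r * i)) = b [^] j" using bgen B_def by blast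
    then have "h = b [^] j \<otimes> d [^] (r * i)" using hG dG bG by (metis inv_solve_right' nat_pow_closed)
    then show ?thesis by blast
  qed
  obtain g where g: "g \<in> carrier G" "\<phi> b = g \<otimes> b \<otimes> inv g" using pw[OF bH] by blast
  obtain g' where g': "g' \<in> carrier G" "\<phi> d = g' \<otimes> d \<otimes> inv g'" using pw[OF dH] by blast
  define w where "w = inv g \<otimes> g'"
  have w: "w \<in> carrier G" unfolding w_def using g g' by simp
  define a where "a = inv d \<otimes> (w \<otimes> d \<otimes> inv w)"
  have aA: "a \<in> A"
    using commutator_in_derived[of "inv d" w] dG w unfolding A_def a_def by (simp add: m_assoc)
  have da: "d \<otimes> a = w \<otimes> d \<otimes> inv w" unfolding a_def using dG w by (simp add: cancel_inv)
  have "(d \<otimes> a) [^] s = \<one>" unfolding da using conj_nat_pow[OF w dG, of s] ds w by simp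
  then obtain e where e: "e \<in> A" "inv e \<otimes> d \<otimes> e = d \<otimes> a"
    using coprime_complement_conj[OF A AC finA dG N.inv_op_closed1[OF dG] aA ds _ cop] by blast
  have eG: "e \<in> carrier G" using e(1) by (rule N.mem_carrier)
  define x where "x = g \<otimes> inv e"
  have x: "x \<in> carrier G" unfolding x_def using g eG by simp
  have xb: "x \<otimes> b \<otimes> inv x = \<phi> b"
  proof -
    have "x \<otimes> b \<otimes> inv x = g \<otimes> (inv e \<otimes> (b \<otimes> e)) \<otimes> inv g"
      unfolding x_def using g eG bG by (simp add: inv_mult_group m_assoc)
    also have "b \<otimes> e = e \<otimes> b" using Acomm[OF bA e(1)] .
    also have "inv e \<otimes> (e \<otimes> b) = b" using eG bG by (simp add: cancel_inv)
    finally show ?thesis using g by simp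
  qed
  have xd: "x \<otimes> d \<otimes> inv x = \<phi> d"
  proof -
    have "x \<otimes> d \<otimes> inv x = g \<otimes> (inv e \<otimes> d \<otimes> e) \<otimes> inv g"
      unfolding x_def using g eG dG by (simp add: inv_mult_group m_assoc)
    also have "\<dots> = g \<otimes> (w \<otimes> d \<otimes> inv w) \<otimes> inv g" using e(2) da by simp
    also have "\<dots> = \<phi> d"
      unfolding w_def using g g' dG by (simp add: inv_mult_group m_assoc cancel_inv)
    finally show ?thesis .
  qed
  have "\<phi> h = x \<otimes> h \<otimes> inv x" if h: "h \<in> H" for h
  proof -
    obtain i j :: nat where ij: "h = b [^] i \<otimes> d [^] j" using form[OF h] by blast
    have "\<phi> h = \<phi> (b [^] i) \<otimes> \<phi> (d [^] j)"
      unfolding ij using \<phi>.hom_mult[of "b [^] i" "d [^] j"]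
        subgroup_nat_pow_closed[OF H bH] subgroup_nat_pow_closed[OF H dH] by simp
    also have "\<dots> = \<phi> b [^] i \<otimes> \<phi> d [^] j"
      using \<phi>.hom_nat_pow[of b i] \<phi>.hom_nat_pow[of d j] bH dH by (simp flip: nat_pow_consistent)
    also have "\<dots> = (x \<otimes> b [^] i \<otimes> inv x) \<otimes> (x \<otimes> d [^] j \<otimes> inv x)"
      unfolding xb[symmetric] xd[symmetric] using conj_nat_pow x bG dG by simp
    also have "\<dots> = x \<otimes> h \<otimes> inv x" unfolding ij using x bG dG by (simp add: m_assoc cancel_inv)
    finally show ?thesis .
  qed
  then show ?thesis using x by blast
qed

section \<open>Group rings of finite groups\<close>

lemma (in group) normalizer_iff:
  assumes "K \<subseteq> carrier G"
  shows "x \<in> normalizer G K \<longleftrightarrow> x \<in> carrier G \<and> (\<lambda>k. x \<otimes> k \<otimes> inv x) ` K = K"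
proof -
  have "x <# K #> inv x = (\<lambda>k. x \<otimes> k \<otimes> inv x) ` K" by (auto simp: l_coset_def r_coset_def)
  then show ?thesis using assms by (simp add: normalizer_def stabilizer_def)
qed

lemma (in abelian_monoid) finsum_swap:
  assumes "finite A" "finite B" "\<And>i j. i \<in> A \<Longrightarrow> j \<in> B \<Longrightarrow> f i j \<in> carrier G"
  shows "(\<Oplus>i\<in>A. \<Oplus>j\<in>B. f i j) = (\<Oplus>j\<in>B. \<Oplus>i\<in>A. f i j)"
  using assms(1,3)
proof (induction A rule: finite_induct)
  case empty
  then show ?case by simp
next
  case (insert a A)
  have "(\<Oplus>i\<in>insert a A. \<Oplus>j\<in>B. f i j) = (\<Oplus>j\<in>B. f a j) \<oplus> (\<Oplus>i\<in>A. \<Oplus>j\<in>B. f i j)"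
    using insert by (intro finsum_insert) (auto intro!: finsum_closed)
  also have "\<dots> = (\<Oplus>j\<in>B. f a j) \<oplus> (\<Oplus>j\<in>B. \<Oplus>i\<in>A. f i j)"
    using insert by simp
  also have "\<dots> = (\<Oplus>j\<in>B. f a j \<oplus> (\<Oplus>i\<in>A. f i j))"
    using insert by (intro finsum_addf[symmetric]) (auto intro!: finsum_closed)
  also have "\<dots> = (\<Oplus>j\<in>B. \<Oplus>i\<in>insert a A. f i j)"
    using insert by (intro finsum_cong' refl finsum_insert[symmetric]) (auto intro!: finsum_closed)
  finally show ?case .
qed

text \<open>
  Over a finite group all functions have finite support, and products can be written as
  sums over the whole group, which makes changes of summation variable possible.
\<close>

locale finite_group_ring = R: cring R + G: group G
  for R :: "('r, 'm) ring_scheme" and G :: "('g, 'n) monoid_scheme" +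
  assumes fin: "finite (carrier G)"
begin

abbreviation "RG \<equiv> group_ring R G"
abbreviation "\<iota> \<equiv> group_ring_embed R G"

lemma carrier_RG: "carrier RG = carrier G \<rightarrow>\<^sub>E carrier R"
  using fin by (auto simp: group_ring_def)

lemma coeff_closed: "a \<in> carrier RG \<Longrightarrow> x \<in> carrier G \<Longrightarrow> a x \<in> carrier R"
  by (auto simp: carrier_RG)

lemma RG_eqI:
  assumes "a \<in> carrier RG" "b \<in> carrier RG" "\<And>x. x \<in> carrier G \<Longrightarrow> a x = b x"
  shows "a = b"
  using assms PiE_ext[of a "carrier G" "\<lambda>_. carrier R" b] by (simp add: carrier_RG)

lemma mult_coeff:
  assumes a: "a \<in> carrier RG" and b: "b \<in> carrier RG" and x: "x \<in> carrier G"
  shows "(a \<otimes>\<^bsub>RG\<^esub> b) x = (\<Oplus>\<^bsub>R\<^esub>y\<in>carrier G. a y \<otimes>\<^bsub>R\<^esub> b (inv\<^bsub>G\<^esub> y \<otimes>\<^bsub>G\<^esub> x))"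
proof -
  have "(a \<otimes>\<^bsub>RG\<^esub> b) x =
      (\<Oplus>\<^bsub>R\<^esub>y\<in>{y \<in> carrier G. a y \<noteq> \<zero>\<^bsub>R\<^esub>}. a y \<otimes>\<^bsub>R\<^esub> b (inv\<^bsub>G\<^esub> y \<otimes>\<^bsub>G\<^esub> x))"
    using x by (simp add: group_ring_def)
  also have "\<dots> = (\<Oplus>\<^bsub>R\<^esub>y\<in>carrier G. a y \<otimes>\<^bsub>R\<^esub> b (inv\<^bsub>G\<^esub> y \<otimes>\<^bsub>G\<^esub> x))"
    using coeff_closed[OF a] coeff_closed[OF b] x fin
    by (intro R.add.finprod_mono_neutral_cong_left) auto
  finally show ?thesis .
qed

lemma mult_closed:
  assumes "a \<in> carrier RG" "b \<in> carrier RG"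
  shows "a \<otimes>\<^bsub>RG\<^esub> b \<in> carrier RG"
proof -
  have "(a \<otimes>\<^bsub>RG\<^esub> b) x \<in> carrier R" if "x \<in> carrier G" for x
    using coeff_closed assms that by (subst mult_coeff) (auto intro!: R.finsum_closed)
  moreover have "(a \<otimes>\<^bsub>RG\<^esub> b) x = undefined" if "x \<notin> carrier G" for x
    using that by (simp add: group_ring_def)
  ultimately show ?thesis unfolding carrier_RG by (intro PiE_I) auto
qed

lemma finsum_translate:
  assumes f: "f \<in> carrier G \<rightarrow> carrier R" and g: "g \<in> carrier G"
  shows "(\<Oplus>\<^bsub>R\<^esub>x\<in>carrier G. f x) = (\<Oplus>\<^bsub>R\<^esub>x\<in>carrier G. f (g \<otimes>\<^bsub>G\<^esub> x))"
  using R.finsum_reindex[of f "\<lambda>x. g \<otimes>\<^bsub>G\<^esub> x" "carrier G"] f g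
    G.surj_const_mult[OF g] G.inj_on_cmult[OF g] by simp

lemma mult_assoc:
  assumes a: "a \<in> carrier RG" and b: "b \<in> carrier RG" and c: "c \<in> carrier RG"
  shows "(a \<otimes>\<^bsub>RG\<^esub> b) \<otimes>\<^bsub>RG\<^esub> c = a \<otimes>\<^bsub>RG\<^esub> (b \<otimes>\<^bsub>RG\<^esub> c)"
proof (rule RG_eqI)
  show "a \<otimes>\<^bsub>RG\<^esub> b \<otimes>\<^bsub>RG\<^esub> c \<in> carrier RG" "a \<otimes>\<^bsub>RG\<^esub> (b \<otimes>\<^bsub>RG\<^esub> c) \<in> carrier RG"
    using a b c by (simp_all add: mult_closed)
next
  fix x assume x: "x \<in> carrier G"
  note cl = coeff_closed[OF a] coeff_closed[OF b] coeff_closed[OF c]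
  let ?t = "\<lambda>y w. a y \<otimes>\<^bsub>R\<^esub> (b (inv\<^bsub>G\<^esub> y \<otimes>\<^bsub>G\<^esub> w) \<otimes>\<^bsub>R\<^esub> c (inv\<^bsub>G\<^esub> w \<otimes>\<^bsub>G\<^esub> x))"
  have "(a \<otimes>\<^bsub>RG\<^esub> b \<otimes>\<^bsub>RG\<^esub> c) x = (\<Oplus>\<^bsub>R\<^esub>w\<in>carrier G. \<Oplus>\<^bsub>R\<^esub>y\<in>carrier G. ?t y w)"
    unfolding mult_coeff[OF mult_closed[OF a b] c x]
  proof (rule R.finsum_cong')
    fix w assume w: "w \<in> carrier G"
    have "(a \<otimes>\<^bsub>RG\<^esub> b) w \<otimes>\<^bsub>R\<^esub> c (inv\<^bsub>G\<^esub> w \<otimes>\<^bsub>G\<^esub> x) =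
        (\<Oplus>\<^bsub>R\<^esub>y\<in>carrier G. a y \<otimes>\<^bsub>R\<^esub> b (inv\<^bsub>G\<^esub> y \<otimes>\<^bsub>G\<^esub> w) \<otimes>\<^bsub>R\<^esub> c (inv\<^bsub>G\<^esub> w \<otimes>\<^bsub>G\<^esub> x))"
      unfolding mult_coeff[OF a b w] using cl w x fin by (intro R.finsum_ldistr) auto
    also have "\<dots> = (\<Oplus>\<^bsub>R\<^esub>y\<in>carrier G. ?t y w)"
      using cl w x by (intro R.finsum_cong') (auto simp: R.m_assoc)
    finally show "(a \<otimes>\<^bsub>RG\<^esub> b) w \<otimes>\<^bsub>R\<^esub> c (inv\<^bsub>G\<^esub> w \<otimes>\<^bsub>G\<^esub> x) = (\<Oplus>\<^bsub>R\<^esub>y\<in>carrier G. ?t y w)" .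
  qed (use cl x in \<open>auto intro!: R.finsum_closed\<close>)
  also have "\<dots> = (\<Oplus>\<^bsub>R\<^esub>y\<in>carrier G. \<Oplus>\<^bsub>R\<^esub>w\<in>carrier G. ?t y w)"
    using cl x fin by (intro R.finsum_swap) auto
  also have "\<dots> = (a \<otimes>\<^bsub>RG\<^esub> (b \<otimes>\<^bsub>RG\<^esub> c)) x"
    unfolding mult_coeff[OF a mult_closed[OF b c] x]
  proof (rule R.finsum_cong')
    fix y assume y: "y \<in> carrier G"
    have "(b \<otimes>\<^bsub>RG\<^esub> c) (inv\<^bsub>G\<^esub> y \<otimes>\<^bsub>G\<^esub> x) =
        (\<Oplus>\<^bsub>R\<^esub>v\<in>carrier G. b v \<otimes>\<^bsub>R\<^esub> c (inv\<^bsub>G\<^esub> v \<otimes>\<^bsub>G\<^esub> (inv\<^bsub>G\<^esub> y \<otimes>\<^bsub>G\<^esub> x)))"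
      using x y by (intro mult_coeff[OF b c]) simp
    also have "\<dots> = (\<Oplus>\<^bsub>R\<^esub>w\<in>carrier G. b (inv\<^bsub>G\<^esub> y \<otimes>\<^bsub>G\<^esub> w) \<otimes>\<^bsub>R\<^esub>
        c (inv\<^bsub>G\<^esub> (inv\<^bsub>G\<^esub> y \<otimes>\<^bsub>G\<^esub> w) \<otimes>\<^bsub>G\<^esub> (inv\<^bsub>G\<^esub> y \<otimes>\<^bsub>G\<^esub> x)))"
      using cl x y by (intro finsum_translate) auto
    also have "\<dots> = (\<Oplus>\<^bsub>R\<^esub>w\<in>carrier G. b (inv\<^bsub>G\<^esub> y \<otimes>\<^bsub>G\<^esub> w) \<otimes>\<^bsub>R\<^esub> c (inv\<^bsub>G\<^esub> w \<otimes>\<^bsub>G\<^esub> x))"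
      using cl x y
      by (intro R.finsum_cong') (auto simp: G.inv_mult_group G.m_assoc G.cancel_inv)
    finally have "a y \<otimes>\<^bsub>R\<^esub> (b \<otimes>\<^bsub>RG\<^esub> c) (inv\<^bsub>G\<^esub> y \<otimes>\<^bsub>G\<^esub> x) = a y \<otimes>\<^bsub>R\<^esub> \<dots>" by simp
    also have "\<dots> = (\<Oplus>\<^bsub>R\<^esub>w\<in>carrier G. ?t y w)"
      using cl x y fin by (intro R.finsum_rdistr) auto
    finally show "(\<Oplus>\<^bsub>R\<^esub>w\<in>carrier G. ?t y w) = a y \<otimes>\<^bsub>R\<^esub> (b \<otimes>\<^bsub>RG\<^esub> c) (inv\<^bsub>G\<^esub> y \<otimes>\<^bsub>G\<^esub> x)" by simp
  qed (use cl coeff_closed[OF mult_closed[OF b c]] x in auto)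
  finally show "(a \<otimes>\<^bsub>RG\<^esub> b \<otimes>\<^bsub>RG\<^esub> c) x = (a \<otimes>\<^bsub>RG\<^esub> (b \<otimes>\<^bsub>RG\<^esub> c)) x" .
qed

lemma embed_closed: "\<iota> g \<in> carrier RG"
  by (auto simp: carrier_RG group_ring_embed_def)

lemma embed_mult_coeff:
  assumes g: "g \<in> carrier G" and b: "b \<in> carrier RG" and x: "x \<in> carrier G"
  shows "(\<iota> g \<otimes>\<^bsub>RG\<^esub> b) x = b (inv\<^bsub>G\<^esub> g \<otimes>\<^bsub>G\<^esub> x)"
proof -
  have "(\<iota> g \<otimes>\<^bsub>RG\<^esub> b) x =
      (\<Oplus>\<^bsub>R\<^esub>y\<in>carrier G. if g = y then b (inv\<^bsub>G\<^esub> y \<otimes>\<^bsub>G\<^esub> x) else \<zero>\<^bsub>R\<^esub>)"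
    unfolding mult_coeff[OF embed_closed b x]
    using coeff_closed[OF b] x by (intro R.finsum_cong') (auto simp: group_ring_embed_def)
  also have "\<dots> = b (inv\<^bsub>G\<^esub> g \<otimes>\<^bsub>G\<^esub> x)"
    using coeff_closed[OF b] x g fin by (intro R.finsum_singleton) auto
  finally show ?thesis .
qed

lemma mult_embed_coeff:
  assumes g: "g \<in> carrier G" and b: "b \<in> carrier RG" and x: "x \<in> carrier G"
  shows "(b \<otimes>\<^bsub>RG\<^esub> \<iota> g) x = b (x \<otimes>\<^bsub>G\<^esub> inv\<^bsub>G\<^esub> g)"
proof -
  have eq: "inv\<^bsub>G\<^esub> y \<otimes>\<^bsub>G\<^esub> x = g \<longleftrightarrow> x \<otimes>\<^bsub>G\<^esub> inv\<^bsub>G\<^esub> g = y" if "y \<in> carrier G" for y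
    using that g x by (metis G.inv_closed G.inv_solve_left' G.inv_solve_right')
  have "(b \<otimes>\<^bsub>RG\<^esub> \<iota> g) x =
      (\<Oplus>\<^bsub>R\<^esub>y\<in>carrier G. if x \<otimes>\<^bsub>G\<^esub> inv\<^bsub>G\<^esub> g = y then b y else \<zero>\<^bsub>R\<^esub>)"
    unfolding mult_coeff[OF b embed_closed x]
    using coeff_closed[OF b] x g by (intro R.finsum_cong') (auto simp: group_ring_embed_def eq)
  also have "\<dots> = b (x \<otimes>\<^bsub>G\<^esub> inv\<^bsub>G\<^esub> g)"
    using coeff_closed[OF b] x g fin by (intro R.finsum_singleton) auto
  finally show ?thesis .
qed

lemma one_RG: "\<one>\<^bsub>RG\<^esub> = \<iota> \<one>\<^bsub>G\<^esub>"
  by (simp add: group_ring_def group_ring_embed_def)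

lemma monoid_RG: "monoid RG"
proof
  show "\<one>\<^bsub>RG\<^esub> \<in> carrier RG" unfolding one_RG by (rule embed_closed)
  show "\<one>\<^bsub>RG\<^esub> \<otimes>\<^bsub>RG\<^esub> a = a" if "a \<in> carrier RG" for a
    unfolding one_RG using that
    by (intro RG_eqI) (auto simp: embed_mult_coeff mult_closed embed_closed)
  show "a \<otimes>\<^bsub>RG\<^esub> \<one>\<^bsub>RG\<^esub> = a" if "a \<in> carrier RG" for a
    unfolding one_RG using that
    by (intro RG_eqI) (auto simp: mult_embed_coeff mult_closed embed_closed)
qed (simp_all add: mult_closed mult_assoc)

lemma embed_mult:
  assumes g: "g \<in> carrier G" and h: "h \<in> carrier G"
  shows "\<iota> g \<otimes>\<^bsub>RG\<^esub> \<iota> h = \<iota> (g \<otimes>\<^bsub>G\<^esub> h)"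
proof (rule RG_eqI)
  fix x assume x: "x \<in> carrier G"
  have "inv\<^bsub>G\<^esub> g \<otimes>\<^bsub>G\<^esub> x = h \<longleftrightarrow> x = g \<otimes>\<^bsub>G\<^esub> h"
    using g h x by (metis G.cancel_inv)
  then show "(\<iota> g \<otimes>\<^bsub>RG\<^esub> \<iota> h) x = \<iota> (g \<otimes>\<^bsub>G\<^esub> h) x"
    using g x by (simp add: embed_mult_coeff[OF g embed_closed x]) (simp add: group_ring_embed_def)
qed (simp_all add: mult_closed embed_closed)

lemma embed_inj:
  assumes "\<one>\<^bsub>R\<^esub> \<noteq> \<zero>\<^bsub>R\<^esub>"
  shows "inj_on \<iota> (carrier G)"
proof (rule inj_onI)
  fix g h assume gh: "g \<in> carrier G" "h \<in> carrier G" "\<iota> g = \<iota> h"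
  then have "\<iota> g g = \<iota> h g" by simp
  then show "g = h" using gh(1,2) assms by (simp add: group_ring_embed_def split: if_splits)
qed

text \<open>
  For a conjugacy class \<open>S\<close> this is a trace function on the group ring.
\<close>

definition class_sum :: "'g set \<Rightarrow> ('g \<Rightarrow> 'r) \<Rightarrow> 'r" where
  "class_sum S a = (\<Oplus>\<^bsub>R\<^esub>x\<in>carrier G. if x \<in> S then a x else \<zero>\<^bsub>R\<^esub>)"

lemma class_sum_mult:
  assumes a: "a \<in> carrier RG" and b: "b \<in> carrier RG"
  shows "class_sum S (a \<otimes>\<^bsub>RG\<^esub> b) =
    (\<Oplus>\<^bsub>R\<^esub>y\<in>carrier G. \<Oplus>\<^bsub>R\<^esub>v\<in>carrier G. if y \<otimes>\<^bsub>G\<^esub> v \<in> S then a y \<otimes>\<^bsub>R\<^esub> b v else \<zero>\<^bsub>R\<^esub>)"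
proof -
  note cl = coeff_closed[OF a] coeff_closed[OF b]
  let ?t = "\<lambda>y x. if x \<in> S then a y \<otimes>\<^bsub>R\<^esub> b (inv\<^bsub>G\<^esub> y \<otimes>\<^bsub>G\<^esub> x) else \<zero>\<^bsub>R\<^esub>"
  have "class_sum S (a \<otimes>\<^bsub>RG\<^esub> b) = (\<Oplus>\<^bsub>R\<^esub>x\<in>carrier G. \<Oplus>\<^bsub>R\<^esub>y\<in>carrier G. ?t y x)"
    unfolding class_sum_def using cl
    by (intro R.finsum_cong') (auto simp: mult_coeff[OF a b] intro!: R.finsum_closed)
  also have "\<dots> = (\<Oplus>\<^bsub>R\<^esub>y\<in>carrier G. \<Oplus>\<^bsub>R\<^esub>x\<in>carrier G. ?t y x)"
    using cl fin by (intro R.finsum_swap) auto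
  also have "\<dots> = (\<Oplus>\<^bsub>R\<^esub>y\<in>carrier G. \<Oplus>\<^bsub>R\<^esub>v\<in>carrier G. if y \<otimes>\<^bsub>G\<^esub> v \<in> S then a y \<otimes>\<^bsub>R\<^esub> b v else \<zero>\<^bsub>R\<^esub>)"
  proof (rule R.finsum_cong')
    fix y assume y: "y \<in> carrier G"
    have "(\<Oplus>\<^bsub>R\<^esub>x\<in>carrier G. ?t y x) = (\<Oplus>\<^bsub>R\<^esub>v\<in>carrier G. ?t y (y \<otimes>\<^bsub>G\<^esub> v))"
      using cl y by (intro finsum_translate) auto
    also have "\<dots> = (\<Oplus>\<^bsub>R\<^esub>v\<in>carrier G. if y \<otimes>\<^bsub>G\<^esub> v \<in> S then a y \<otimes>\<^bsub>R\<^esub> b v else \<zero>\<^bsub>R\<^esub>)"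
      using cl y by (intro R.finsum_cong') (auto simp: G.cancel_inv)
    finally show "(\<Oplus>\<^bsub>R\<^esub>x\<in>carrier G. ?t y x) =
      (\<Oplus>\<^bsub>R\<^esub>v\<in>carrier G. if y \<otimes>\<^bsub>G\<^esub> v \<in> S then a y \<otimes>\<^bsub>R\<^esub> b v else \<zero>\<^bsub>R\<^esub>)" .
  qed (use cl in \<open>auto intro!: R.finsum_closed\<close>)
  finally show ?thesis .
qed

text \<open>
  Both sides sum \<open>a y \<otimes> b v\<close> over pairs: on the left over those with \<open>y v \<in> S\<close>, on the
  right over those with \<open>v y \<in> S\<close>. These are the same pairs, as \<open>v y\<close> and \<open>y v\<close> are
  conjugate.
\<close>

lemma class_sum_commute:
  assumes a: "a \<in> carrier RG" and b: "b \<in> carrier RG"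
    and S: "\<And>x g. x \<in> S \<Longrightarrow> x \<in> carrier G \<Longrightarrow> g \<in> carrier G \<Longrightarrow> g \<otimes>\<^bsub>G\<^esub> x \<otimes>\<^bsub>G\<^esub> inv\<^bsub>G\<^esub> g \<in> S"
  shows "class_sum S (a \<otimes>\<^bsub>RG\<^esub> b) = class_sum S (b \<otimes>\<^bsub>RG\<^esub> a)"
proof -
  note cl = coeff_closed[OF a] coeff_closed[OF b]
  have imp: "v \<otimes>\<^bsub>G\<^esub> y \<in> S" if "y \<otimes>\<^bsub>G\<^esub> v \<in> S" "y \<in> carrier G" "v \<in> carrier G" for y v
    using S[OF that(1), of "inv\<^bsub>G\<^esub> y"] that(2,3) by (simp add: G.m_assoc G.cancel_inv)
  have "class_sum S (a \<otimes>\<^bsub>RG\<^esub> b) =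
      (\<Oplus>\<^bsub>R\<^esub>v\<in>carrier G. \<Oplus>\<^bsub>R\<^esub>y\<in>carrier G. if y \<otimes>\<^bsub>G\<^esub> v \<in> S then a y \<otimes>\<^bsub>R\<^esub> b v else \<zero>\<^bsub>R\<^esub>)"
    unfolding class_sum_mult[OF a b] using cl fin by (intro R.finsum_swap) auto
  also have "\<dots> = class_sum S (b \<otimes>\<^bsub>RG\<^esub> a)"
    unfolding class_sum_mult[OF b a] using cl imp
    by (intro R.finsum_cong' refl) (auto intro!: R.finsum_closed simp: R.m_comm)
  finally show ?thesis .
qed

lemma class_sum_embed:
  assumes g: "g \<in> carrier G"
  shows "class_sum S (\<iota> g) = (if g \<in> S then \<one>\<^bsub>R\<^esub> else \<zero>\<^bsub>R\<^esub>)"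
proof -
  have "class_sum S (\<iota> g) =
      (\<Oplus>\<^bsub>R\<^esub>x\<in>carrier G. if g = x then if x \<in> S then \<one>\<^bsub>R\<^esub> else \<zero>\<^bsub>R\<^esub> else \<zero>\<^bsub>R\<^esub>)"
    unfolding class_sum_def by (intro R.finsum_cong') (auto simp: group_ring_embed_def)
  also have "\<dots> = (if g \<in> S then \<one>\<^bsub>R\<^esub> else \<zero>\<^bsub>R\<^esub>)"
    using g fin by (intro R.finsum_singleton) auto
  finally show ?thesis .
qed

text \<open>
  The class sum over the class \<open>S\<close> of \<open>h\<close> is 1 at \<open>h\<close>. It has the same value at \<open>k\<close>, since
  \<open>k = u (h u\<^sup>-\<^sup>1)\<close> and \<open>h = (h u\<^sup>-\<^sup>1) u\<close>; hence \<open>k \<in> S\<close>.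
\<close>

lemma unit_conj_imp_group_conj:
  assumes nt: "\<one>\<^bsub>R\<^esub> \<noteq> \<zero>\<^bsub>R\<^esub>" and u: "u \<in> Units RG" and h: "h \<in> carrier G" and k: "k \<in> carrier G"
    and eq: "u \<otimes>\<^bsub>RG\<^esub> \<iota> h = \<iota> k \<otimes>\<^bsub>RG\<^esub> u"
  shows "\<exists>g\<in>carrier G. k = g \<otimes>\<^bsub>G\<^esub> h \<otimes>\<^bsub>G\<^esub> inv\<^bsub>G\<^esub> g"
proof -
  interpret RG: monoid RG by (rule monoid_RG)
  define S where "S = {g \<otimes>\<^bsub>G\<^esub> h \<otimes>\<^bsub>G\<^esub> inv\<^bsub>G\<^esub> g | g. g \<in> carrier G}"
  have S: "g \<otimes>\<^bsub>G\<^esub> x \<otimes>\<^bsub>G\<^esub> inv\<^bsub>G\<^esub> g \<in> S" if "x \<in> S" "g \<in> carrier G" for x g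
  proof -
    obtain t where t: "t \<in> carrier G" "x = t \<otimes>\<^bsub>G\<^esub> h \<otimes>\<^bsub>G\<^esub> inv\<^bsub>G\<^esub> t" using \<open>x \<in> S\<close> by (auto simp: S_def)
    then have "g \<otimes>\<^bsub>G\<^esub> x \<otimes>\<^bsub>G\<^esub> inv\<^bsub>G\<^esub> g = (g \<otimes>\<^bsub>G\<^esub> t) \<otimes>\<^bsub>G\<^esub> h \<otimes>\<^bsub>G\<^esub> inv\<^bsub>G\<^esub> (g \<otimes>\<^bsub>G\<^esub> t)"
      using that(2) h by (simp add: G.inv_mult_group G.m_assoc)
    then show ?thesis unfolding S_def using t(1) that(2) by blast
  qed
  have "h = \<one>\<^bsub>G\<^esub> \<otimes>\<^bsub>G\<^esub> h \<otimes>\<^bsub>G\<^esub> inv\<^bsub>G\<^esub> \<one>\<^bsub>G\<^esub>" using h by simp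
  then have hS: "h \<in> S" unfolding S_def by blast
  let ?v = "inv\<^bsub>RG\<^esub> u"
  have uc: "u \<in> carrier RG" "?v \<in> carrier RG" using u by auto
  have "u \<otimes>\<^bsub>RG\<^esub> (\<iota> h \<otimes>\<^bsub>RG\<^esub> ?v) = \<iota> k"
  proof -
    have "u \<otimes>\<^bsub>RG\<^esub> (\<iota> h \<otimes>\<^bsub>RG\<^esub> ?v) = \<iota> k \<otimes>\<^bsub>RG\<^esub> u \<otimes>\<^bsub>RG\<^esub> ?v"
      unfolding mult_assoc[OF uc(1) embed_closed uc(2), symmetric] eq ..
    also have "\<dots> = \<iota> k \<otimes>\<^bsub>RG\<^esub> (u \<otimes>\<^bsub>RG\<^esub> ?v)" by (rule mult_assoc[OF embed_closed uc])
    finally show ?thesis using u embed_closed by simp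
  qed
  moreover have "(\<iota> h \<otimes>\<^bsub>RG\<^esub> ?v) \<otimes>\<^bsub>RG\<^esub> u = \<iota> h"
    using uc u by (simp add: mult_assoc embed_closed)
  ultimately have "class_sum S (\<iota> k) = class_sum S (\<iota> h)"
    using class_sum_commute[OF uc(1) mult_closed[OF embed_closed uc(2)], of S h] S by simp
  then have "k \<in> S" using hS nt class_sum_embed h k by (simp split: if_splits)
  then show ?thesis by (auto simp: S_def)
qed

section \<open>Normalizers in the unit group\<close>

lemma embed_unit:
  assumes g: "g \<in> carrier G"
  shows "\<iota> g \<in> Units RG" "inv\<^bsub>units_of RG\<^esub> (\<iota> g) = \<iota> (inv\<^bsub>G\<^esub> g)"
proof -
  interpret RG: monoid RG by (rule monoid_RG)
  have 1: "\<iota> g \<otimes>\<^bsub>RG\<^esub> \<iota> (inv\<^bsub>G\<^esub> g) = \<one>\<^bsub>RG\<^esub>" "\<iota> (inv\<^bsub>G\<^esub> g) \<otimes>\<^bsub>RG\<^esub> \<iota> g = \<one>\<^bsub>RG\<^esub>"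
    using g by (simp_all add: embed_mult one_RG)
  then show u: "\<iota> g \<in> Units RG" unfolding Units_def using embed_closed by blast
  show "inv\<^bsub>units_of RG\<^esub> (\<iota> g) = \<iota> (inv\<^bsub>G\<^esub> g)"
    using RG.units_of_inv[OF u] RG.inv_unique'[of "\<iota> g" "\<iota> (inv\<^bsub>G\<^esub> g)"] 1 embed_closed by simp
qed

text \<open>
  Conjugation by \<open>u\<close> defines a homomorphism \<open>\<phi>\<close> on \<open>H\<close> that is pointwise conjugation in
  \<open>G\<close>, hence conjugation by a single \<open>g\<close>. Then \<open>u = g c\<close> with \<open>c = g\<^sup>-\<^sup>1 u\<close> centralizing
  \<open>H\<close>.
\<close>

theorem normalizer_units_group_ring:
  assumes nt: "\<one>\<^bsub>R\<^esub> \<noteq> \<zero>\<^bsub>R\<^esub>" and Z: "p_subgroups_cyclic G" and H: "subgroup H G"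
  shows "normalizer (units_of RG) (\<iota> ` H) =
    (\<iota> ` normalizer G H) <#>\<^bsub>units_of RG\<^esub> centralizer (units_of RG) (\<iota> ` H)"
proof -
  interpret RG: monoid RG by (rule monoid_RG)
  define U where "U = units_of RG"
  interpret U: group U unfolding U_def by (rule RG.units_group)
  have UC: "carrier U = Units RG" unfolding U_def by (rule units_of_carrier)
  have Um: "x \<otimes>\<^bsub>U\<^esub> y = x \<otimes>\<^bsub>RG\<^esub> y" for x y unfolding U_def by (simp add: units_of_mult)
  have HG: "h \<in> carrier G" if "h \<in> H" for h using subgroup.mem_carrier[OF H that] .
  have e: "\<iota> g \<in> carrier U" if "g \<in> carrier G" for g using embed_unit(1)[OF that] UC by simp
  have em: "\<iota> g \<otimes>\<^bsub>U\<^esub> \<iota> h = \<iota> (g \<otimes>\<^bsub>G\<^esub> h)" if "g \<in> carrier G" "h \<in> carrier G" for g h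
    using embed_mult[OF that] Um by simp
  have ei: "inv\<^bsub>U\<^esub> (\<iota> g) = \<iota> (inv\<^bsub>G\<^esub> g)" if "g \<in> carrier G" for g
    using embed_unit(2)[OF that] U_def by simp
  have inj: "inj_on \<iota> (carrier G)" by (rule embed_inj[OF nt])
  have NU: "x \<in> normalizer U (\<iota> ` H) \<longleftrightarrow>
      x \<in> carrier U \<and> (\<lambda>k. x \<otimes>\<^bsub>U\<^esub> k \<otimes>\<^bsub>U\<^esub> inv\<^bsub>U\<^esub> x) ` \<iota> ` H = \<iota> ` H" for x
    using HG e by (intro U.normalizer_iff) auto
  have NG: "x \<in> normalizer G H \<longleftrightarrow>
      x \<in> carrier G \<and> (\<lambda>k. x \<otimes>\<^bsub>G\<^esub> k \<otimes>\<^bsub>G\<^esub> inv\<^bsub>G\<^esub> x) ` H = H" for x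
    by (rule G.normalizer_iff[OF subgroup.subset[OF H]])
  have "normalizer U (\<iota> ` H) = (\<iota> ` normalizer G H) <#>\<^bsub>U\<^esub> centralizer U (\<iota> ` H)"
  proof (intro Set.set_eqI iffI)
    fix u assume "u \<in> (\<iota> ` normalizer G H) <#>\<^bsub>U\<^esub> centralizer U (\<iota> ` H)"
    then obtain n c where n: "n \<in> normalizer G H" and c: "c \<in> centralizer U (\<iota> ` H)"
      and u: "u = \<iota> n \<otimes>\<^bsub>U\<^esub> c" by (auto simp: set_mult_def)
    have nG: "n \<in> carrier G" and nH: "(\<lambda>k. n \<otimes>\<^bsub>G\<^esub> k \<otimes>\<^bsub>G\<^esub> inv\<^bsub>G\<^esub> n) ` H = H"
      using n NG by auto
    have cU: "c \<in> carrier U" and cc: "\<And>h. h \<in> H \<Longrightarrow> c \<otimes>\<^bsub>U\<^esub> \<iota> h = \<iota> h \<otimes>\<^bsub>U\<^esub> c"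
      using c by (auto simp: centralizer_def)
    have "u \<otimes>\<^bsub>U\<^esub> \<iota> h \<otimes>\<^bsub>U\<^esub> inv\<^bsub>U\<^esub> u = \<iota> (n \<otimes>\<^bsub>G\<^esub> h \<otimes>\<^bsub>G\<^esub> inv\<^bsub>G\<^esub> n)" if h: "h \<in> H" for h
    proof -
      have "u \<otimes>\<^bsub>U\<^esub> \<iota> h \<otimes>\<^bsub>U\<^esub> inv\<^bsub>U\<^esub> u = \<iota> n \<otimes>\<^bsub>U\<^esub> (c \<otimes>\<^bsub>U\<^esub> \<iota> h \<otimes>\<^bsub>U\<^esub> inv\<^bsub>U\<^esub> c) \<otimes>\<^bsub>U\<^esub> inv\<^bsub>U\<^esub> (\<iota> n)"
        unfolding u using e[OF nG] e[OF HG[OF h]] cU by (simp add: U.inv_mult_group U.m_assoc)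
      also have "c \<otimes>\<^bsub>U\<^esub> \<iota> h \<otimes>\<^bsub>U\<^esub> inv\<^bsub>U\<^esub> c = \<iota> h"
        using cc[OF h] cU e[OF HG[OF h]] by (simp add: U.m_assoc)
      finally show ?thesis using nG HG[OF h] by (simp add: ei em)
    qed
    then have "(\<lambda>k. u \<otimes>\<^bsub>U\<^esub> k \<otimes>\<^bsub>U\<^esub> inv\<^bsub>U\<^esub> u) ` \<iota> ` H = \<iota> ` (\<lambda>k. n \<otimes>\<^bsub>G\<^esub> k \<otimes>\<^bsub>G\<^esub> inv\<^bsub>G\<^esub> n) ` H"
      unfolding image_image by (intro image_cong) auto
    then show "u \<in> normalizer U (\<iota> ` H)" using NU u e[OF nG] cU nH by simp
  next
    fix u assume "u \<in> normalizer U (\<iota> ` H)"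
    then have uU: "u \<in> carrier U" and uH: "(\<lambda>k. u \<otimes>\<^bsub>U\<^esub> k \<otimes>\<^bsub>U\<^esub> inv\<^bsub>U\<^esub> u) ` \<iota> ` H = \<iota> ` H"
      using NU by auto
    have "\<forall>h\<in>H. \<exists>k\<in>H. u \<otimes>\<^bsub>U\<^esub> \<iota> h \<otimes>\<^bsub>U\<^esub> inv\<^bsub>U\<^esub> u = \<iota> k" using uH by blast
    then obtain \<phi> where \<phi>H: "\<And>h. h \<in> H \<Longrightarrow> \<phi> h \<in> H"
      and \<phi>0: "\<And>h. h \<in> H \<Longrightarrow> u \<otimes>\<^bsub>U\<^esub> \<iota> h \<otimes>\<^bsub>U\<^esub> inv\<^bsub>U\<^esub> u = \<iota> (\<phi> h)"
      by metis
    have \<phi>: "u \<otimes>\<^bsub>U\<^esub> \<iota> h = \<iota> (\<phi> h) \<otimes>\<^bsub>U\<^esub> u" if h: "h \<in> H" for h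
      using U.conj_eq_iff_commute[OF uU e[OF HG[OF h]] e[OF HG[OF \<phi>H[OF h]]]] \<phi>0[OF h] by simp
    have "\<phi> \<in> hom (G\<lparr>carrier := H\<rparr>) G"
    proof (rule homI)
      show "\<phi> h \<in> carrier G" if "h \<in> carrier (G\<lparr>carrier := H\<rparr>)" for h
        using that HG \<phi>H by simp
      fix h k assume "h \<in> carrier (G\<lparr>carrier := H\<rparr>)" "k \<in> carrier (G\<lparr>carrier := H\<rparr>)"
      then have hk: "h \<in> H" "k \<in> H" by auto
      have hkH: "h \<otimes>\<^bsub>G\<^esub> k \<in> H" using subgroup.m_closed[OF H hk] .
      note c = HG[OF hk(1)] HG[OF hk(2)] HG[OF \<phi>H[OF hk(1)]] HG[OF \<phi>H[OF hk(2)]]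
      have "\<iota> (\<phi> (h \<otimes>\<^bsub>G\<^esub> k)) \<otimes>\<^bsub>U\<^esub> u = u \<otimes>\<^bsub>U\<^esub> \<iota> h \<otimes>\<^bsub>U\<^esub> \<iota> k"
        using \<phi>[OF hkH] uU e c by (simp add: U.m_assoc em)
      also have "\<dots> = \<iota> (\<phi> h) \<otimes>\<^bsub>U\<^esub> (u \<otimes>\<^bsub>U\<^esub> \<iota> k)"
        unfolding \<phi>[OF hk(1)] using uU e c by (simp add: U.m_assoc)
      also have "\<dots> = \<iota> (\<phi> h \<otimes>\<^bsub>G\<^esub> \<phi> k) \<otimes>\<^bsub>U\<^esub> u"
        unfolding \<phi>[OF hk(2)] em[OF c(3,4), symmetric] using uU e c by (simp add: U.m_assoc)
      finally have "\<iota> (\<phi> (h \<otimes>\<^bsub>G\<^esub> k)) = \<iota> (\<phi> h \<otimes>\<^bsub>G\<^esub> \<phi> k)"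
        using uU e c HG[OF \<phi>H[OF hkH]] by simp
      then show "\<phi> (h \<otimes>\<^bsub>G\<lparr>carrier := H\<rparr>\<^esub> k) = \<phi> h \<otimes>\<^bsub>G\<^esub> \<phi> k"
        using inj_onD[OF inj] c HG[OF \<phi>H[OF hkH]] by simp
    qed
    moreover have "\<exists>g\<in>carrier G. \<phi> h = g \<otimes>\<^bsub>G\<^esub> h \<otimes>\<^bsub>G\<^esub> inv\<^bsub>G\<^esub> g" if h: "h \<in> H" for h
      using unit_conj_imp_group_conj[OF nt _ HG[OF h] HG[OF \<phi>H[OF h]]] \<phi>[OF h] uU
      unfolding UC Um by blast
    ultimately obtain g where g: "g \<in> carrier G"
      and \<phi>g: "\<And>h. h \<in> H \<Longrightarrow> \<phi> h = g \<otimes>\<^bsub>G\<^esub> h \<otimes>\<^bsub>G\<^esub> inv\<^bsub>G\<^esub> g"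
      using G.pointwise_conj_hom_is_conj[OF fin Z H] by blast
    have "\<iota> ` \<phi> ` H = \<iota> ` H"
      using uH \<phi>0 by (auto simp: image_image cong: image_cong)
    then have "\<phi> ` H = H"
      using inj_on_image_eq_iff[OF inj, of "\<phi> ` H" H] HG \<phi>H by auto
    then have gN: "g \<in> normalizer G H" using NG g \<phi>g by (auto cong: image_cong)
    define c where "c = \<iota> (inv\<^bsub>G\<^esub> g) \<otimes>\<^bsub>U\<^esub> u"
    have cU: "c \<in> carrier U" unfolding c_def using e g uU by simp
    have "c \<otimes>\<^bsub>U\<^esub> \<iota> h = \<iota> h \<otimes>\<^bsub>U\<^esub> c" if h: "h \<in> H" for h
    proof -
      note hG = HG[OF h]
      have "c \<otimes>\<^bsub>U\<^esub> \<iota> h = \<iota> (inv\<^bsub>G\<^esub> g) \<otimes>\<^bsub>U\<^esub> (u \<otimes>\<^bsub>U\<^esub> \<iota> h)"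
        unfolding c_def using e g uU hG by (simp add: U.m_assoc)
      also have "\<dots> = \<iota> (inv\<^bsub>G\<^esub> g \<otimes>\<^bsub>G\<^esub> (g \<otimes>\<^bsub>G\<^esub> h \<otimes>\<^bsub>G\<^esub> inv\<^bsub>G\<^esub> g)) \<otimes>\<^bsub>U\<^esub> u"
        unfolding \<phi>[OF h] \<phi>g[OF h] using e g uU hG by (simp add: em flip: U.m_assoc)
      also have "inv\<^bsub>G\<^esub> g \<otimes>\<^bsub>G\<^esub> (g \<otimes>\<^bsub>G\<^esub> h \<otimes>\<^bsub>G\<^esub> inv\<^bsub>G\<^esub> g) = h \<otimes>\<^bsub>G\<^esub> inv\<^bsub>G\<^esub> g"
        using g hG by (simp add: G.m_assoc G.cancel_inv)
      also have "\<iota> (h \<otimes>\<^bsub>G\<^esub> inv\<^bsub>G\<^esub> g) \<otimes>\<^bsub>U\<^esub> u = \<iota> h \<otimes>\<^bsub>U\<^esub> c"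
        unfolding c_def using e g uU hG by (simp add: U.m_assoc flip: em)
      finally show ?thesis .
    qed
    then have "c \<in> centralizer U (\<iota> ` H)" using cU by (auto simp: centralizer_def)
    moreover have "u = \<iota> g \<otimes>\<^bsub>U\<^esub> c"
      unfolding c_def using e[OF g] uU g by (simp add: U.cancel_inv flip: ei)
    ultimately show "u \<in> (\<iota> ` normalizer G H) <#>\<^bsub>U\<^esub> centralizer U (\<iota> ` H)"
      unfolding set_mult_def using gN by blast
  qed
  then show ?thesis unfolding U_def .
qed

end

theorem corollary13:
  fixes R :: "('r, 'm) ring_scheme" and G :: "('g, 'n) monoid_scheme"
  assumes "cring R" and "\<one>\<^bsub>R\<^esub> \<noteq> \<zero>\<^bsub>R\<^esub>"
    and "group G" and "finite (carrier G)"
  shows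
    "let U = units_of (group_ring R G); \<iota> = group_ring_embed R G in
       ((\<forall>p P. sylow_subgroup p P G \<longrightarrow> cyclic_group (G\<lparr>carrier := P\<rparr>)) \<longrightarrow>
         (\<forall>H. subgroup H G \<longrightarrow>
           normalizer U (\<iota> ` H) = (\<iota> ` normalizer G H) <#>\<^bsub>U\<^esub> centralizer U (\<iota> ` H))) \<and>
       (squarefree (Coset.order G) \<longrightarrow>
         (\<forall>H. subgroup H G \<longrightarrow>
           normalizer U (\<iota> ` H) = (\<iota> ` normalizer G H) <#>\<^bsub>U\<^esub> centralizer U (\<iota> ` H)))"
proof -
  interpret finite_group_ring R G
    using assms by (simp add: finite_group_ring_def finite_group_ring_axioms_def)
  have main: "normalizer (units_of RG) (\<iota> ` H) =
      (\<iota> ` normalizer G H) <#>\<^bsub>units_of RG\<^esub> centralizer (units_of RG) (\<iota> ` H)"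
    if "\<And>p P. sylow_subgroup p P G \<Longrightarrow> cyclic_group (G\<lparr>carrier := P\<rparr>)" "subgroup H G" for H
    using normalizer_units_group_ring[OF assms(2) G.p_subgroups_cyclicI[OF fin that(1)] that(2)] .
  show ?thesis
    unfolding Let_def using main G.squarefree_order_sylow_cyclic[OF fin] by blast
qed

end
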